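(* For every positive integer $n$, the rank (over the reals) of the forest compatibility matrix $F_n$ is at most $C_n$, the $n$-th Catalan number. In particular $\operatorname{rank}(F_n)=O(4^n n^{-3/2})$.
   Context: $[n]=\{1,\dots,n\}$. A boundaried graph with boundary $[n]$ is a graph on vertex set $[n]\cup V$. A forest $G$ with boundary $[n]$ is a representative forest of a partition $\pi$ of $[n]$ if for every block $S\in\pi$ there is a connected component $C$ of $G$ with $C\cap[n]=S$. The glue $G\oplus H$ of two boundaried graphs with boundary $[n]$ is obtained from their disjoint union by identifying each boundary vertex of $G$ with its copy in $H$. Two partitions $\pi,\rho$ of $[n]$ induce a cycle if $G_\pi\oplus G_\rho$ contains a cycle, where $G_\pi,G_\rho$ are representative forests of $\pi,\rho$ (this does not depend on the choice of representatives). The forest compatibility matrix $F_n$ has rows and columns indexed by partitions of $[n]$, with $F_n[\pi,\rho]=0$ if $\pi$ and $\rho$ induce a cycle and $F_n[\pi,\rho]=1$ otherwise. *)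

theory Defs
  imports
    "HOL-Library.Disjoint_Sets"
    "HOL-Library.Landau_Symbols"
    "Jordan_Normal_Form.DL_Rank"
begin

text \<open>
  Undirected multigraphs. Parallel edges are needed because gluing may create them: if each of two
  representative forests contains an edge between the boundary vertices \<open>1\<close> and \<open>2\<close>, then the glue
  contains two such edges, and they form a cycle of length two. This is what makes
  \<open>induces_cycle\<close> below independent of the chosen representatives.
\<close>

record ('v, 'e) multigraph =
  verts :: "'v set"
  edges :: "'e set"
  ends  :: "'e \<Rightarrow> 'v set"

definition is_multigraph :: "('v, 'e) multigraph \<Rightarrow> bool" where
  "is_multigraph G \<longleftrightarrow> finite (verts G) \<and> finite (edges G) \<and>
     (\<forall>e\<in>edges G. ends G e \<subseteq> verts G \<and> card (ends G e) \<in> {1, 2})"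

text \<open>A loop is a cycle of length one, and a pair of parallel edges is a cycle of length two.\<close>

definition is_cycle :: "('v, 'e) multigraph \<Rightarrow> 'v list \<Rightarrow> 'e list \<Rightarrow> bool" where
  "is_cycle G vs es \<longleftrightarrow>
     vs \<noteq> [] \<and> length es = length vs \<and> distinct vs \<and> distinct es \<and>
     set vs \<subseteq> verts G \<and> set es \<subseteq> edges G \<and>
     (\<forall>i<length vs. ends G (es ! i) = {vs ! i, vs ! (Suc i mod length vs)})"

definition contains_cycle :: "('v, 'e) multigraph \<Rightarrow> bool" where
  "contains_cycle G \<longleftrightarrow> (\<exists>vs es. is_cycle G vs es)"

definition is_forest :: "('v, 'e) multigraph \<Rightarrow> bool" where
  "is_forest G \<longleftrightarrow> is_multigraph G \<and> \<not> contains_cycle G"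

definition adjacency :: "('v, 'e) multigraph \<Rightarrow> 'v rel" where
  "adjacency G = {(u, v). \<exists>e\<in>edges G. ends G e = {u, v}}"

definition connected_component_of :: "('v, 'e) multigraph \<Rightarrow> 'v set \<Rightarrow> bool" where
  "connected_component_of G C \<longleftrightarrow>
     (\<exists>u\<in>verts G. C = {v \<in> verts G. (u, v) \<in> (adjacency G)\<^sup>*})"

datatype 'a bvertex = Boundary nat | Internal 'a

definition has_boundary :: "nat \<Rightarrow> ('a bvertex, 'e) multigraph \<Rightarrow> bool" where
  "has_boundary n G \<longleftrightarrow> {i. Boundary i \<in> verts G} = {1..n}"

definition representative_forest ::
    "nat \<Rightarrow> nat set set \<Rightarrow> ('a bvertex, 'e) multigraph \<Rightarrow> bool" where
  "representative_forest n P G \<longleftrightarrow>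
     is_forest G \<and> has_boundary n G \<and>
     (\<forall>S\<in>P. \<exists>C. connected_component_of G C \<and> C \<inter> Boundary ` {1..n} = Boundary ` S)"

text \<open>
  The internal vertices and the edges of the two graphs are kept apart by the injections into the
  sum type, whereas \<open>map_bvertex\<close> leaves every boundary vertex \<open>Boundary i\<close> unchanged.
\<close>

definition glue ::
    "('a bvertex, 'e) multigraph \<Rightarrow> ('b bvertex, 'f) multigraph \<Rightarrow>
     (('a + 'b) bvertex, 'e + 'f) multigraph" where
  "glue G H =
     \<lparr>verts = map_bvertex Inl ` verts G \<union> map_bvertex Inr ` verts H,
      edges = edges G <+> edges H,
      ends = case_sum (\<lambda>e. map_bvertex Inl ` ends G e) (\<lambda>e. map_bvertex Inr ` ends H e)\<rparr>"

text \<open>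
  Since the graphs are finite, drawing internal vertices and edge names from the naturals covers
  all boundaried graphs up to isomorphism.
\<close>

definition induces_cycle :: "nat \<Rightarrow> nat set set \<Rightarrow> nat set set \<Rightarrow> bool" where
  "induces_cycle n P Q \<longleftrightarrow>
     (\<exists>(G :: (nat bvertex, nat) multigraph) (H :: (nat bvertex, nat) multigraph).
        representative_forest n P G \<and> representative_forest n Q H \<and> contains_cycle (glue G H))"

text \<open>
  The matrix type has index set \<open>{0..<N}\<close>, so the partitions are listed in an arbitrary order, the
  same one for rows and columns. The rank does not depend on it.
\<close>

definition partition_list :: "nat \<Rightarrow> nat set set list" where
  "partition_list n = (SOME Ps. distinct Ps \<and> set Ps = {P. partition_on {1..n} P})"

definition forest_compat_matrix :: "nat \<Rightarrow> real mat" where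
  "forest_compat_matrix n =
     (let Ps = partition_list n
      in mat (length Ps) (length Ps)
           (\<lambda>(i, j). if induces_cycle n (Ps ! i) (Ps ! j) then 0 else 1))"

definition real_rank :: "real mat \<Rightarrow> nat" where
  "real_rank A = vec_space.rank (dim_row A) A"

definition catalan :: "nat \<Rightarrow> real" where
  "catalan n = real ((2 * n) choose n) / real (n + 1)"

end

theory Submission
  imports Defs
begin

text \<open>
  Viewing the points of \<open>[n]\<close> as edges between the blocks of two partitions, the partitions induce a
  cycle iff some nonempty set of points has minimum degree two, i.e. meets no block in exactly one
  point. In this form merging two blocks creates a cycle iff they were already connected, and for
  four blocks \<open>A, B, C, D\<close> this gives the linear relation between rows of the matrix

    \<open>AC|BD + AB|CD + AD|BC + ABCD = ABC|D + ABD|C + ACD|B + BCD|A\<close>.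

  A row whose partition has a singleton, or two adjacent points in one block, is the image of a row
  for \<open>n - 1\<close> under a linear map. Modulo such rows the relation says that swapping two adjacent
  points changes the sign, so two points of one block can be moved next to each other, and all rows
  are combinations of those obtained from the one-point partition by repeatedly inserting a
  singleton or doubling a point. In Temperley--Lieb terms every such step inserts a cup at some
  position \<open>p\<close>; cups at distant positions commute, so the positions can be chosen with
  \<open>p\<^sub>k\<^sub>+\<^sub>1 \<le> p\<^sub>k + 1\<close>, and the number of such sequences is the Catalan number.
\<close>

section \<open>Acyclicity of pairs of equivalence relations\<close>

text \<open>
  For the relations of two partitions, \<open>S\<close> is an edge set of minimum degree two in the multigraph
  whose vertices are the blocks and whose edges are the points.
\<close>

definition core :: "('a \<Rightarrow> 'a \<Rightarrow> bool) \<Rightarrow> ('a \<Rightarrow> 'a \<Rightarrow> bool) \<Rightarrow> bool" where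
  "core R Q \<longleftrightarrow> (\<exists>S. finite S \<and> S \<noteq> {} \<and>
     (\<forall>x\<in>S. (\<exists>y\<in>S. y \<noteq> x \<and> R x y) \<and> (\<exists>y\<in>S. y \<noteq> x \<and> Q x y)))"

text \<open>For an equivalence \<open>R\<close> this closed form is already the equivalence
  generated by \<open>R\<close> and the pair \<open>(a, b)\<close>.\<close>

definition merge :: "'a \<Rightarrow> 'a \<Rightarrow> ('a \<Rightarrow> 'a \<Rightarrow> bool) \<Rightarrow> 'a \<Rightarrow> 'a \<Rightarrow> bool" where
  "merge a b R x y \<longleftrightarrow> R x y \<or> R x a \<and> R b y \<or> R x b \<and> R a y"

text \<open>Two points are joined when, as edges of the block multigraph, they lie in the same
  connected component.\<close>

definition joined :: "('a \<Rightarrow> 'a \<Rightarrow> bool) \<Rightarrow> ('a \<Rightarrow> 'a \<Rightarrow> bool) \<Rightarrow> 'a \<Rightarrow> 'a \<Rightarrow> bool" where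
  "joined R Q = (\<lambda>x y. R x y \<or> Q x y)\<^sup>*\<^sup>*"

lemma core_commute: "core R Q = core Q R"
  unfolding core_def by blast

lemma core_mono:
  assumes "core R Q" "\<And>x y. R x y \<Longrightarrow> R' x y"
  shows "core R' Q"
proof -
  obtain S where S: "finite S" "S \<noteq> {}"
    "\<forall>x\<in>S. (\<exists>y\<in>S. y \<noteq> x \<and> R x y) \<and> (\<exists>y\<in>S. y \<noteq> x \<and> Q x y)"
    using assms(1) unfolding core_def by blast
  have "(\<exists>y\<in>S. y \<noteq> x \<and> R' x y) \<and> (\<exists>y\<in>S. y \<noteq> x \<and> Q x y)" if "x \<in> S" for x
    using S(3) that assms(2) by meson
  then show ?thesis unfolding core_def using S(1,2) by blast
qed

lemma equivp_merge: "equivp R \<Longrightarrow> equivp (merge a b R)"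
  unfolding equivp_reflp_symp_transp reflp_def symp_def transp_def merge_def by meson

lemma merge_related: "equivp R \<Longrightarrow> merge a b R a b"
  unfolding merge_def by (simp add: equivp_reflp)

text \<open>Deleting the deficient point leaves at most one deficient point, now for the other relation.\<close>

lemma core_if_one_deficient:
  assumes "finite S" "x \<in> S" "equivp R" "equivp Q"
    "\<And>y. y \<in> S \<Longrightarrow> \<exists>z\<in>S. z \<noteq> y \<and> Q y z"
    "\<And>y. y \<in> S \<Longrightarrow> y \<noteq> x \<Longrightarrow> \<exists>z\<in>S. z \<noteq> y \<and> R y z"
  shows "core R Q"
  using assms
proof (induction "card S" arbitrary: S x R Q rule: less_induct)
  case less
  show ?case
  proof (cases "\<exists>z\<in>S. z \<noteq> x \<and> R x z")
    case True
    then show ?thesis unfolding core_def using less.prems by blast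
  next
    case False
    obtain z where z: "z \<in> S" "z \<noteq> x" "Q x z" using less.prems(2,5) by blast
    have "core Q R"
    proof (rule less.hyps[of "S - {x}" z Q R])
      show "card (S - {x}) < card S" using less.prems by (metis card_Diff1_less)
      show "\<exists>w\<in>S - {x}. w \<noteq> y \<and> R y w" if "y \<in> S - {x}" for y
        using less.prems(6)[of y] that False equivp_symp[OF less.prems(3)] by blast
      show "\<exists>w\<in>S - {x}. w \<noteq> y \<and> Q y w" if "y \<in> S - {x}" "y \<noteq> z" for y
      proof -
        obtain w where w: "w \<in> S" "w \<noteq> y" "Q y w" using less.prems(5)[of y] \<open>y \<in> S - {x}\<close> by blast
        \<comment> \<open>The partner \<open>w\<close> of \<open>y\<close> may be the deleted point;
          then \<open>z\<close>, in the same \<open>Q\<close> block, takes its place.\<close>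
        show ?thesis
        proof (cases "w = x")
          case True
          then have "Q y z" using w z equivp_transp[OF less.prems(4), of y x z] by blast
          then show ?thesis using z \<open>y \<noteq> z\<close> by (intro bexI[of _ z]) auto
        qed (use w in blast)
      qed
    qed (use less.prems z in auto)
    then show ?thesis using core_commute by blast
  qed
qed

section \<open>Connected components, alternating walks and merging of blocks\<close>

lemma joined_refl: "joined R Q x x" by (simp add: joined_def)

lemma equivp_joined:
  assumes "equivp R" "equivp Q" shows "equivp (joined R Q)"
  unfolding joined_def
  by (intro equivp_rtranclp sympI) (metis assms equivp_symp)

lemma joined_commute: "joined R Q = joined Q R"
  unfolding joined_def by (metis (no_types, lifting))

lemma joined_left: "R x y \<Longrightarrow> joined R Q x y"
  and joined_right: "Q x y \<Longrightarrow> joined R Q x y"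
  unfolding joined_def by auto

text \<open>Identifying two vertices fuses their components and changes no others. With this,
  \<open>core_merge\<close> can be applied repeatedly and still be expressed by the original
  components.\<close>

lemma joined_merge:
  assumes R: "equivp R" and Q: "equivp Q"
  shows "joined (merge a b R) Q = merge a b (joined R Q)"
proof (intro ext iffI)
  note J = equivp_joined[OF R Q]
  note M = equivp_merge[OF J, of a b]
  fix x y
  show "merge a b (joined R Q) x y" if "joined (merge a b R) Q x y"
    using that unfolding joined_def[of "merge a b R"]
  proof (induction rule: rtranclp_induct)
    case base show ?case using M by (simp add: equivp_reflp)
  next
    case (step y z)
    have "merge a b (joined R Q) y z"
      using step.hyps(2) unfolding merge_def using joined_left[of R] joined_right[of Q] by meson
    then show ?case using step.IH equivp_transp[OF M] by blast
  qed
  have J': "equivp (joined (merge a b R) Q)" by (intro equivp_joined equivp_merge R Q)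
  have le: "joined (merge a b R) Q u v" if "joined R Q u v" for u v
    using that unfolding joined_def by (rule rtranclp_mono[THEN predicate2D, rotated]) (auto simp: merge_def)
  have ab: "joined (merge a b R) Q a b" by (intro joined_left merge_related R)
  assume "merge a b (joined R Q) x y"
  then consider "joined R Q x y" | "joined R Q x a" "joined R Q b y" | "joined R Q x b" "joined R Q a y"
    unfolding merge_def by blast
  then show "joined (merge a b R) Q x y"
  proof cases
    case 1
    then show ?thesis by (rule le)
  next
    case 2
    then show ?thesis using le ab equivp_transp[OF J'] by meson
  next
    case 3
    then show ?thesis using le equivp_symp[OF J' ab] equivp_transp[OF J'] by meson
  qed
qed

text \<open>The walk leaves the block of \<open>a\<close>, alternates between the relations and ends
  with a \<open>Q\<close> step. All steps are nontrivial except possibly the first \<open>R\<close>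
  step, so consecutive points are genuine partners.\<close>

inductive alternating_walk for R Q a where
  start: "R a x \<Longrightarrow> Q x y \<Longrightarrow> x \<noteq> y \<Longrightarrow> alternating_walk R Q a y"
| step: "alternating_walk R Q a y \<Longrightarrow> R y x \<Longrightarrow> x \<noteq> y \<Longrightarrow> Q x z \<Longrightarrow> z \<noteq> x \<Longrightarrow> alternating_walk R Q a z"

text \<open>Trivial steps are dropped and consecutive steps in one relation are fused. A final
  \<open>R\<close> step is not part of a walk, hence the separate \<open>R x z\<close>.\<close>

lemma joined_imp_alternating_walk:
  assumes R: "equivp R" and Q: "equivp Q" and "joined R Q a z"
  shows "R a z \<or> (\<exists>x. R x z \<and> alternating_walk R Q a x)"
  using assms(3) unfolding joined_def
proof (induction rule: rtranclp_induct)
  case base show ?case using R by (simp add: equivp_reflp)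
next
  case (step z z')
  show ?case
  proof (cases "R z z' \<or> z = z'")
    case True
    then show ?thesis using step.IH equivp_transp[OF R] by blast
  next
    case False
    then have Qz: "Q z z'" and ne: "z \<noteq> z'" using step.hyps by auto
    consider "R a z" | x where "R x z" "alternating_walk R Q a x" using step.IH by blast
    then show ?thesis
    proof cases
      case 1
      then show ?thesis using Qz ne alternating_walk.start[of R a z Q z'] equivp_reflp[OF R] by blast
    next
      case 2
      \<comment> \<open>If the walk already ends at \<open>z\<close>, its last \<open>Q\<close> step
        is prolonged to \<open>z'\<close>; if that step began at \<open>z'\<close>, it cancels
        instead.\<close>
      show ?thesis
      proof (cases "x = z")
        case False
        then show ?thesis using 2 Qz ne alternating_walk.step[of R Q a x z z'] equivp_reflp[OF R] by blast
      next
        case True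
        with 2 have "alternating_walk R Q a z" by simp
        then show ?thesis
        proof cases
          case (start w)
          then show ?thesis using Qz equivp_transp[OF Q, of w z z'] equivp_reflp[OF R]
            by (metis alternating_walk.start)
        next
          case (step y w)
          then show ?thesis using Qz equivp_transp[OF Q, of w z z'] equivp_reflp[OF R]
            by (metis alternating_walk.step)
        qed
      qed
    qed
  qed
qed

text \<open>The set consists of the endpoints of the \<open>Q\<close> steps. The \<open>R\<close>
  steps between them supply the \<open>R\<close> partners, except at the end of the walk and in the
  block of \<open>a\<close>.\<close>

lemma alternating_walk_support:
  assumes R: "equivp R" and Q: "equivp Q" and "alternating_walk R Q a x"
  shows "\<exists>S. finite S \<and> x \<in> S \<and> (\<exists>y\<in>S. R a y) \<and>
    (\<forall>y\<in>S. (\<exists>z\<in>S. z \<noteq> y \<and> Q y z) \<and> (y = x \<or> R a y \<or> (\<exists>z\<in>S. z \<noteq> y \<and> R y z)))"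
  using assms(3)
proof induction
  case (start x y)
  then show ?case using equivp_symp[OF Q] by (intro exI[of _ "{x, y}"]) auto
next
  case (step y x z)
  then obtain S where S: "finite S" "y \<in> S" "\<exists>y\<in>S. R a y"
    "\<forall>v\<in>S. (\<exists>z\<in>S. z \<noteq> v \<and> Q v z) \<and> (v = y \<or> R a v \<or> (\<exists>z\<in>S. z \<noteq> v \<and> R v z))" by blast
  have "R x y" "Q z x" using step equivp_symp R Q by metis+
  let ?S = "insert x (insert z S)"
  have "(\<exists>w\<in>?S. w \<noteq> v \<and> Q v w) \<and> (v = z \<or> R a v \<or> (\<exists>w\<in>?S. w \<noteq> v \<and> R v w))" if v: "v \<in> ?S" for v
  proof -
    consider "v = x" | "v = z" | "v = y" "v \<noteq> x" "v \<noteq> z" | "v \<in> S" "v \<noteq> y" using v by blast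
    then show ?thesis
    proof cases
      case 1
      then show ?thesis using \<open>R x y\<close> \<open>y \<in> S\<close> \<open>x \<noteq> y\<close> \<open>Q x z\<close> \<open>z \<noteq> x\<close> by auto
    next
      case 2
      then show ?thesis using \<open>Q z x\<close> \<open>z \<noteq> x\<close> by auto
    next
      case 3
      then show ?thesis using S(2,4) \<open>R y x\<close> by auto
    next
      case 4
      then show ?thesis using S(4) by auto
    qed
  qed
  then show ?case using S(1,3) by (intro exI[of _ ?S]) auto
qed

text \<open>In graph terms, identifying two vertices closes a cycle exactly when a path already
  joined them. The points of an alternating walk between the two blocks lack \<open>R\<close>
  partners only in these blocks, and the merge supplies them.\<close>

lemma core_merge:
  assumes R: "equivp R" and Q: "equivp Q" and ab: "\<not> R a b"
  shows "core (merge a b R) Q \<longleftrightarrow> core R Q \<or> joined R Q a b"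
proof (intro iffI; (elim disjE)?)
  show "core (merge a b R) Q" if "core R Q"
    using that by (rule core_mono) (simp add: merge_def)
next
  assume "joined R Q a b"
  then obtain x where x: "R x b" "alternating_walk R Q a x"
    using joined_imp_alternating_walk[OF R Q, of a b] ab by blast
  then obtain S where S: "finite S" "x \<in> S" "\<exists>y\<in>S. R a y"
    "\<forall>y\<in>S. (\<exists>z\<in>S. z \<noteq> y \<and> Q y z) \<and> (y = x \<or> R a y \<or> (\<exists>z\<in>S. z \<noteq> y \<and> R y z))"
    using alternating_walk_support[OF R Q x(2)] by blast
  have nx: "\<not> R a x" using x(1) ab equivp_transp[OF R, of a x b] by blast
  have "\<exists>z\<in>S. z \<noteq> y \<and> merge a b R y z" if y: "y \<in> S" for y
  proof -
    consider "y = x" | "R a y" | "\<exists>z\<in>S. z \<noteq> y \<and> R y z" using S(4) y by blast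
    then show ?thesis
    proof cases
      case 1
      moreover obtain w where "w \<in> S" "R a w" using S(3) by blast
      ultimately show ?thesis using x(1) nx unfolding merge_def by (intro bexI[of _ w]) auto
    next
      case 2
      then have "merge a b R y x" "x \<noteq> y"
        unfolding merge_def using x(1) nx equivp_symp[OF R, of a y] equivp_symp[OF R, of x b] by auto
      then show ?thesis using S(2) by blast
    qed (auto simp: merge_def)
  qed
  then show "core (merge a b R) Q" unfolding core_def using S by blast
next
  assume "core (merge a b R) Q"
  then obtain S where S: "finite S" "S \<noteq> {}"
    "\<And>x. x \<in> S \<Longrightarrow> \<exists>y\<in>S. y \<noteq> x \<and> merge a b R x y" "\<And>x. x \<in> S \<Longrightarrow> \<exists>y\<in>S. y \<noteq> x \<and> Q x y"
    unfolding core_def by blast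
  note J = equivp_joined[OF R Q]
  show "core R Q \<or> joined R Q a b"
  proof (rule disjCI)
    assume nj: "\<not> joined R Q a b"
    show "core R Q"
    proof (cases "\<forall>x\<in>S. \<exists>y\<in>S. y \<noteq> x \<and> R x y")
      case True
      then show ?thesis unfolding core_def using S by blast
    next
      case False
      then obtain x where x: "x \<in> S" "\<And>y. y \<in> S \<Longrightarrow> y \<noteq> x \<Longrightarrow> \<not> R x y" by blast
      have x_ab: "R x a \<or> R x b" using S(3)[OF x(1)] x(2) unfolding merge_def by blast
      \<comment> \<open>Only the component of the deficient point \<open>x\<close> is kept. A second
        deficient point there would lie in the other merged block and so join \<open>a\<close> to
        \<open>b\<close>.\<close>
      define T where "T = {y\<in>S. joined R Q x y}"
      have T: "\<exists>z\<in>T. z \<noteq> y \<and> Q y z" if y: "y \<in> T" for y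
      proof -
        obtain z where z: "z \<in> S" "z \<noteq> y" "Q y z" using S(4)[of y] y by (auto simp: T_def)
        then have "joined R Q x z" using y equivp_transp[OF J, of x y z] joined_right[of Q y z R]
          by (auto simp: T_def)
        then show ?thesis using z by (auto simp: T_def)
      qed
      have T': "\<exists>z\<in>T. z \<noteq> y \<and> R y z" if y: "y \<in> T" "y \<noteq> x" for y
      proof -
        have yS: "y \<in> S" and xy: "joined R Q x y" using y by (auto simp: T_def)
        obtain z where z: "z \<in> S" "z \<noteq> y" "merge a b R y z" using S(3)[OF yS] by blast
        show ?thesis
        proof (cases "R y z")
          case True
          then have "joined R Q x z" using xy equivp_transp[OF J, of x y z] joined_left[of R y z Q] by auto
          then show ?thesis using z True by (auto simp: T_def)
        next
          case False
          have nxy: "\<not> R x y" using x(2) y yS by blast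
          have "R y a \<or> R y b" using z False by (auto simp: merge_def)
          then consider "R x a" "R y b" | "R x b" "R y a"
            using x_ab nxy equivp_transp[OF R, of x _ y] equivp_symp[OF R, of y] by blast
          then have "joined R Q a b"
          proof cases
            case 1
            then show ?thesis using equivp_transp[OF J] equivp_symp[OF J] xy joined_left[of R] by meson
          next
            case 2
            then show ?thesis using equivp_transp[OF J] equivp_symp[OF J] xy joined_left[of R] by meson
          qed
          then show ?thesis using nj by blast
        qed
      qed
      show ?thesis
        by (rule core_if_one_deficient[of T x])
           (use S x T T' R Q in \<open>auto simp: T_def joined_refl\<close>)
    qed
  qed
qed

text \<open>Both sides say that there is a core already or that \<open>a\<close> and
  \<open>b\<close> are joined. A merge can thus be moved from rows to columns.\<close>

lemma core_merge_swap:
  assumes "equivp R" "equivp Q" "\<not> R a b" "\<not> Q a b"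
  shows "core (merge a b R) Q = core R (merge a b Q)"
  using core_merge[OF assms(1,2,3)] core_merge[OF assms(2,1,4)]
  by (simp add: core_commute[of R] joined_commute[of R])

definition acyclic_entry :: "('a \<Rightarrow> 'a \<Rightarrow> bool) \<Rightarrow> ('a \<Rightarrow> 'a \<Rightarrow> bool) \<Rightarrow> real" where
  "acyclic_entry R Q = (if core R Q then 0 else 1)"

text \<open>Every term depends only on \<open>core R Q\<close> and on how the components partition
  the four points, so the identity is a finite check.\<close>

lemma uncrossing:
  assumes R: "equivp R" and Q: "equivp Q"
    and ne: "\<not> R a b" "\<not> R a c" "\<not> R a d" "\<not> R b c" "\<not> R b d" "\<not> R c d"
  shows "acyclic_entry (merge b d (merge a c R)) Q =
      acyclic_entry (merge b c (merge a b R)) Q + acyclic_entry (merge b d (merge a b R)) Q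
    + acyclic_entry (merge a d (merge c d R)) Q + acyclic_entry (merge b d (merge c d R)) Q
    - acyclic_entry (merge a b (merge c d R)) Q - acyclic_entry (merge b c (merge a d R)) Q
    - acyclic_entry (merge a b (merge a d (merge c d R))) Q"
proof -
  define J where "J = joined R Q"
  have J: "equivp J" unfolding J_def by (intro equivp_joined R Q)
  have ne': "\<not> R b a" "\<not> R c a" "\<not> R d a" "\<not> R c b" "\<not> R d b" "\<not> R d c"
    using ne equivp_symp[OF R] by blast+
  have two: "core (merge x y (merge u v R)) Q \<longleftrightarrow> core R Q \<or> J u v \<or> merge u v J x y"
    if "\<not> R u v" "\<not> merge u v R x y" for x y u v
    using that R Q by (simp add: core_merge equivp_merge joined_merge J_def)
  have three: "core (merge p q (merge x y (merge u v R))) Q \<longleftrightarrow>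
      core R Q \<or> J u v \<or> merge u v J x y \<or> merge x y (merge u v J) p q"
    if "\<not> R u v" "\<not> merge u v R x y" "\<not> merge x y (merge u v R) p q" for x y u v p q
    using that R Q by (simp add: core_merge equivp_merge joined_merge J_def)
  have r: "R x x" "J x x" for x using R J by (auto intro: equivp_reflp)
  have s: "J b a = J a b" "J c a = J a c" "J d a = J a d" "J c b = J b c" "J d b = J b d" "J d c = J c d"
    using equivp_symp[OF J] by blast+
  have t: "J a b \<and> J a c \<longrightarrow> J b c" "J a b \<and> J b c \<longrightarrow> J a c" "J a c \<and> J b c \<longrightarrow> J a b"
    "J a b \<and> J a d \<longrightarrow> J b d" "J a b \<and> J b d \<longrightarrow> J a d" "J a d \<and> J b d \<longrightarrow> J a b"
    "J a c \<and> J a d \<longrightarrow> J c d" "J a c \<and> J c d \<longrightarrow> J a d" "J a d \<and> J c d \<longrightarrow> J a c"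
    "J b c \<and> J b d \<longrightarrow> J c d" "J b c \<and> J c d \<longrightarrow> J b d" "J b d \<and> J c d \<longrightarrow> J b c"
    using equivp_transp[OF J] equivp_symp[OF J] by meson+
  have cores:
    "core (merge b d (merge a c R)) Q \<longleftrightarrow> core R Q \<or> J a c \<or> merge a c J b d"
    "core (merge b c (merge a b R)) Q \<longleftrightarrow> core R Q \<or> J a b \<or> merge a b J b c"
    "core (merge b d (merge a b R)) Q \<longleftrightarrow> core R Q \<or> J a b \<or> merge a b J b d"
    "core (merge a d (merge c d R)) Q \<longleftrightarrow> core R Q \<or> J c d \<or> merge c d J a d"
    "core (merge b d (merge c d R)) Q \<longleftrightarrow> core R Q \<or> J c d \<or> merge c d J b d"
    "core (merge a b (merge c d R)) Q \<longleftrightarrow> core R Q \<or> J c d \<or> merge c d J a b"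
    "core (merge b c (merge a d R)) Q \<longleftrightarrow> core R Q \<or> J a d \<or> merge a d J b c"
    by (rule two; simp add: merge_def ne ne' r)+
  have "core (merge a b (merge a d (merge c d R))) Q \<longleftrightarrow>
      core R Q \<or> J c d \<or> merge c d J a d \<or> merge a d (merge c d J) a b"
    by (rule three; simp add: merge_def ne ne' r)
  note cores = cores this
  \<comment> \<open>The triangle conditions leave 15 of the 64 assignments, one for each partition
    of the four points.\<close>
  have bools: "\<forall>ab ac bc ad bd cd.
      (ab \<and> ac \<longrightarrow> bc) \<and> (ab \<and> bc \<longrightarrow> ac) \<and> (ac \<and> bc \<longrightarrow> ab) \<and>
      (ab \<and> ad \<longrightarrow> bd) \<and> (ab \<and> bd \<longrightarrow> ad) \<and> (ad \<and> bd \<longrightarrow> ab) \<and>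
      (ac \<and> ad \<longrightarrow> cd) \<and> (ac \<and> cd \<longrightarrow> ad) \<and> (ad \<and> cd \<longrightarrow> ac) \<and>
      (bc \<and> bd \<longrightarrow> cd) \<and> (bc \<and> cd \<longrightarrow> bd) \<and> (bd \<and> cd \<longrightarrow> bc) \<longrightarrow>
      (if ac \<or> bd \<or> ab \<and> cd \<or> bc \<and> ad then 0 else 1 :: real) =
      (if ab \<or> bc \<or> ac then 0 else 1) + (if ab \<or> bd \<or> ad then 0 else 1) +
      (if cd \<or> ad \<or> ac then 0 else 1) + (if cd \<or> bd \<or> bc then 0 else 1) -
      (if cd \<or> ab \<or> ac \<and> bd \<or> ad \<and> bc then 0 else 1) -
      (if ad \<or> bc \<or> ab \<and> cd \<or> bd \<and> ac then 0 else 1) -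
      (if cd \<or> ad \<or> ac \<or> ab \<or> bd \<or> bc then 0 else 1)"
    unfolding all_bool_eq by simp
  have simplified:
    "core (merge b d (merge a c R)) Q \<longleftrightarrow> core R Q \<or> J a c \<or> J b d \<or> J a b \<and> J c d \<or> J b c \<and> J a d"
    "core (merge b c (merge a b R)) Q \<longleftrightarrow> core R Q \<or> J a b \<or> J b c \<or> J a c"
    "core (merge b d (merge a b R)) Q \<longleftrightarrow> core R Q \<or> J a b \<or> J b d \<or> J a d"
    "core (merge a d (merge c d R)) Q \<longleftrightarrow> core R Q \<or> J c d \<or> J a d \<or> J a c"
    "core (merge b d (merge c d R)) Q \<longleftrightarrow> core R Q \<or> J c d \<or> J b d \<or> J b c"
    "core (merge a b (merge c d R)) Q \<longleftrightarrow> core R Q \<or> J c d \<or> J a b \<or> J a c \<and> J b d \<or> J a d \<and> J b c"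
    "core (merge b c (merge a d R)) Q \<longleftrightarrow> core R Q \<or> J a d \<or> J b c \<or> J a b \<and> J c d \<or> J b d \<and> J a c"
    "core (merge a b (merge a d (merge c d R))) Q \<longleftrightarrow> core R Q \<or> J c d \<or> J a d \<or> J a c \<or> J a b \<or> J b d \<or> J b c"
    unfolding cores merge_def s using r by blast+
  show ?thesis
  proof (cases "core R Q")
    case False
    show ?thesis unfolding acyclic_entry_def simplified using False
      by (simp only: simp_thms)
         (rule bools[THEN spec, THEN spec, THEN spec, THEN spec, THEN spec, THEN spec, THEN mp], intro conjI t)
  qed (simp add: acyclic_entry_def cores)
qed

section \<open>Rows spanned by normal forms\<close>

definition skip :: "nat \<Rightarrow> nat \<Rightarrow> nat" where
  "skip i a = (if a < i then a else Suc a)"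

text \<open>\<open>skip i\<close> and \<open>collapse i\<close> are the coface and codegeneracy maps
  of the simplex category: the first misses \<open>i\<close>, the second takes the value
  \<open>i\<close> at both \<open>i\<close> and \<open>Suc i\<close>.\<close>

definition collapse :: "nat \<Rightarrow> nat \<Rightarrow> nat" where
  "collapse i x = (if x \<le> i then x else x - 1)"

definition insert_point :: "nat \<Rightarrow> (nat \<Rightarrow> nat \<Rightarrow> bool) \<Rightarrow> nat \<Rightarrow> nat \<Rightarrow> bool" where
  "insert_point i R x y \<longleftrightarrow> (if x = i \<or> y = i then x = y else R (collapse i x) (collapse i y))"

definition double_point :: "nat \<Rightarrow> (nat \<Rightarrow> nat \<Rightarrow> bool) \<Rightarrow> nat \<Rightarrow> nat \<Rightarrow> bool" where
  "double_point i R x y \<longleftrightarrow> R (collapse i x) (collapse i y)"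

definition delete_point :: "nat \<Rightarrow> (nat \<Rightarrow> nat \<Rightarrow> bool) \<Rightarrow> nat \<Rightarrow> nat \<Rightarrow> bool" where
  "delete_point i R a b \<longleftrightarrow> R (skip i a) (skip i b)"

text \<open>
  Even positions insert a singleton and odd ones double a point. In the thickened diagram, where
  each point becomes two strands, both insert a cup at position \<open>p\<close>.
\<close>

definition extend_rel :: "nat \<Rightarrow> (nat \<Rightarrow> nat \<Rightarrow> bool) \<Rightarrow> nat \<Rightarrow> nat \<Rightarrow> bool" where
  "extend_rel p R = (if even p then insert_point (p div 2) R else double_point (p div 2) R)"

text \<open>
  Partitions of \<open>{0..<n}\<close> are encoded as equivalences on all naturals that are trivial from \<open>n\<close> on.
  This makes \<open>extend_rel_commute\<close> an equality of relations.
\<close>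

definition partition_rel :: "nat \<Rightarrow> (nat \<Rightarrow> nat \<Rightarrow> bool) \<Rightarrow> bool" where
  "partition_rel n R \<longleftrightarrow> equivp R \<and> (\<forall>x y. R x y \<longrightarrow> x = y \<or> x < n \<and> y < n)"

lemma skip_neq: "skip i a \<noteq> i"
  and inj_skip: "inj (skip i)"
  and collapse_skip: "collapse i (skip i a) = a"
  and skip_collapse: "x \<noteq> i \<Longrightarrow> skip i (collapse i x) = x"
  by (auto simp: skip_def collapse_def inj_def)

lemma equivp_collapse_skip:
  assumes "equivp R"
  shows "equivp (insert_point i R)" "equivp (double_point i R)" "equivp (delete_point i R)"
proof -
  note R = equivp_reflp[OF assms] equivp_symp[OF assms] equivp_transp[OF assms]
  show "equivp (insert_point i R)"
    by (intro equivpI reflpI sympI transpI) (auto simp: insert_point_def R(1) intro: R(2) R(3) split: if_splits)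
  show "equivp (double_point i R)" "equivp (delete_point i R)"
    by (intro equivpI reflpI sympI transpI; use R in \<open>unfold double_point_def delete_point_def, blast\<close>)+
qed

lemma delete_insert_point: "delete_point i (insert_point i R) = R"
  by (intro ext) (simp add: delete_point_def insert_point_def skip_neq collapse_skip)

lemma insert_delete_point:
  assumes "equivp R" "\<And>y. R i y \<Longrightarrow> y = i"
  shows "insert_point i (delete_point i R) = R"
proof (intro ext)
  fix x y
  have "R x i \<longleftrightarrow> x = i" "R i y \<longleftrightarrow> y = i"
    using assms(2) equivp_symp[OF assms(1)] equivp_reflp[OF assms(1)] by metis+
  then show "insert_point i (delete_point i R) x y = R x y"
    by (auto simp: insert_point_def delete_point_def skip_collapse)
qed

lemma double_delete_point:
  assumes "equivp R" "R i (Suc i)"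
  shows "double_point i (delete_point i R) = R"
proof (intro ext)
  fix x y
  \<comment> \<open>The composite moves only \<open>i\<close>, and moves it to \<open>Suc i\<close>,
    which is related to it.\<close>
  have 1: "R x (skip i (collapse i x))" for x
    using assms equivp_reflp[OF assms(1)] by (cases "x = i") (auto simp: skip_collapse, simp add: skip_def collapse_def)
  show "double_point i (delete_point i R) x y = R x y"
    unfolding double_point_def delete_point_def
    using 1[of x] 1[of y] equivp_transp[OF assms(1)] equivp_symp[OF assms(1)] by meson
qed

text \<open>After the insertion the old point \<open>i\<close> sits at \<open>Suc i\<close>, so
  doubling it means merging it with the new singleton. In this form \<open>core_merge_swap\<close>
  applies.\<close>

lemma double_point_eq_merge:
  assumes "equivp R"
  shows "double_point i R = merge i (Suc i) (insert_point i R)"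
proof (intro ext)
  fix x y
  have c: "collapse i (Suc i) = i" "collapse i i = i" by (auto simp: collapse_def)
  show "double_point i R x y = merge i (Suc i) (insert_point i R) x y"
    using equivp_reflp[OF assms] equivp_symp[OF assms, of i] equivp_symp[OF assms, of _ i]
      equivp_transp[OF assms, of "collapse i x" i "collapse i y"]
    by (auto simp: double_point_def merge_def insert_point_def c)
qed

text \<open>A point alone in its \<open>R\<close> block lies in no witness set, and
  \<open>skip i\<close> renumbers the other points.\<close>

lemma core_delete_isolated:
  assumes "\<And>y. R i y \<Longrightarrow> y = i"
  shows "core R Q \<longleftrightarrow> core (delete_point i R) (delete_point i Q)"
proof
  assume "core R Q"
  then obtain S where S: "finite S" "S \<noteq> {}"
    "\<forall>x\<in>S. (\<exists>y\<in>S. y \<noteq> x \<and> R x y) \<and> (\<exists>y\<in>S. y \<noteq> x \<and> Q x y)" unfolding core_def by blast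
  have i: "i \<notin> S" using S(3) assms by blast
  define T where "T = skip i -` S"
  have ST: "S = skip i ` T" 
  proof
    show "S \<subseteq> skip i ` T"
    proof
      fix x assume "x \<in> S"
      then have "x = skip i (collapse i x)" using i skip_collapse[of x i] by metis
      then show "x \<in> skip i ` T" using \<open>x \<in> S\<close> by (metis T_def imageI vimageI)
    qed
  qed (auto simp: T_def)
  have "finite T" unfolding T_def by (rule finite_vimageI[OF S(1) inj_skip])
  moreover have "T \<noteq> {}" using S(2) ST by auto
  moreover have "\<forall>x\<in>T. (\<exists>y\<in>T. y \<noteq> x \<and> delete_point i R x y) \<and> (\<exists>y\<in>T. y \<noteq> x \<and> delete_point i Q x y)"
    using S(3) unfolding ST delete_point_def by (simp add: inj_eq[OF inj_skip])
  ultimately show "core (delete_point i R) (delete_point i Q)" unfolding core_def by blast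
next
  assume "core (delete_point i R) (delete_point i Q)"
  then obtain T where T: "finite T" "T \<noteq> {}"
    "\<forall>x\<in>T. (\<exists>y\<in>T. y \<noteq> x \<and> delete_point i R x y) \<and> (\<exists>y\<in>T. y \<noteq> x \<and> delete_point i Q x y)"
    unfolding core_def by blast
  then have "finite (skip i ` T)" "skip i ` T \<noteq> {}"
    "\<forall>x\<in>skip i ` T. (\<exists>y\<in>skip i ` T. y \<noteq> x \<and> R x y) \<and> (\<exists>y\<in>skip i ` T. y \<noteq> x \<and> Q x y)"
    unfolding delete_point_def by (simp_all add: inj_eq[OF inj_skip])
  then show "core R Q" unfolding core_def by blast
qed

lemma core_insert_point: "core (insert_point i R) Q \<longleftrightarrow> core R (delete_point i Q)"
  by (subst core_delete_isolated[of _ i]) (auto simp: insert_point_def delete_insert_point)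

text \<open>If \<open>Q\<close> relates the twins, they form a cycle of length two. Otherwise the
  merge is moved to \<open>Q\<close>, which leaves an inserted singleton on the other side.\<close>

lemma core_double_point:
  assumes R: "equivp R" and Q: "equivp Q"
  shows "core (double_point i R) Q \<longleftrightarrow> Q i (Suc i) \<or> core R (delete_point i (merge i (Suc i) Q))"
proof (cases "Q i (Suc i)")
  case True
  have "double_point i R i (Suc i)" "double_point i R (Suc i) i"
    by (auto simp: double_point_def collapse_def equivp_reflp[OF R])
  then have "core (double_point i R) Q"
    unfolding core_def using True equivp_symp[OF Q True] by (intro exI[of _ "{i, Suc i}"]) auto
  then show ?thesis using True by simp
next
  case False
  have "core (double_point i R) Q \<longleftrightarrow> core (insert_point i R) (merge i (Suc i) Q)"
    unfolding double_point_eq_merge[OF R] using False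
    by (intro core_merge_swap equivp_collapse_skip R Q) (auto simp: insert_point_def)
  then show ?thesis using False by (simp add: core_insert_point)
qed

text \<open>The adjoint of \<open>extend_rel p\<close>, acting on columns: an inserted singleton
  becomes a deletion, a doubled point a contraction of the twins.\<close>

definition restrict_rel :: "nat \<Rightarrow> (nat \<Rightarrow> nat \<Rightarrow> bool) \<Rightarrow> nat \<Rightarrow> nat \<Rightarrow> bool" where
  "restrict_rel p Q = delete_point (p div 2) (if even p then Q else merge (p div 2) (Suc (p div 2)) Q)"

text \<open>The right side is linear in the row of \<open>R\<close>, with coefficients that depend
  on \<open>p\<close> and \<open>Q\<close> only. Linear relations among rows therefore pass to the
  extended rows.\<close>

lemma acyclic_entry_extend:
  assumes "equivp R" "equivp Q"
  shows "acyclic_entry (extend_rel p R) Q =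
    (if odd p \<and> Q (p div 2) (Suc (p div 2)) then 0 else acyclic_entry R (restrict_rel p Q))"
  using assms by (simp add: acyclic_entry_def extend_rel_def restrict_rel_def core_insert_point core_double_point)

lemma partition_rel_merge:
  assumes "partition_rel n R" "a < n" "b < n"
  shows "partition_rel n (merge a b R)"
proof -
  have R: "R x y \<Longrightarrow> x = y \<or> x < n \<and> y < n" for x y using assms(1) by (simp add: partition_rel_def)
  have "x = y \<or> x < n \<and> y < n" if "merge a b R x y" for x y
    using that R[of x y] R[of x a] R[of b y] R[of x b] R[of a y] assms(2,3) by (auto simp: merge_def)
  then show ?thesis using assms(1) equivp_merge[of R a b] by (simp add: partition_rel_def)
qed

lemma partition_rel_delete:
  assumes "partition_rel (Suc n) R" "i \<le> n"
  shows "partition_rel n (delete_point i R)"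
proof -
  have "a = b \<or> a < n \<and> b < n" if "delete_point i R a b" for a b
  proof -
    have "skip i a = skip i b \<or> skip i a < Suc n \<and> skip i b < Suc n"
      using assms(1) that unfolding partition_rel_def delete_point_def by blast
    then show ?thesis using assms(2) by (auto simp: skip_def split: if_splits)
  qed
  then show ?thesis using assms(1) equivp_collapse_skip(3) unfolding partition_rel_def by blast
qed

lemma partition_rel_restrict:
  assumes "partition_rel (Suc n) Q" "p \<le> 2 * n"
  shows "partition_rel n (restrict_rel p Q)"
proof (cases "even p")
  case True
  then show ?thesis using assms by (auto simp: restrict_rel_def intro!: partition_rel_delete)
next
  case False
  then have "p div 2 < n" using assms(2) by presburger
  then show ?thesis using assms(1) False
    by (auto simp: restrict_rel_def intro!: partition_rel_delete partition_rel_merge)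
qed

lemma partition_rel_extend:
  assumes "partition_rel n R" "p \<le> 2 * n"
  shows "partition_rel (Suc n) (extend_rel p R)"
proof -
  have eq: "equivp R" using assms(1) by (simp add: partition_rel_def)
  have R: "R x y \<Longrightarrow> x = y \<or> x < n \<and> y < n" for x y using assms(1) by (simp add: partition_rel_def)
  have "x = y \<or> x < Suc n \<and> y < Suc n" if "extend_rel p R x y" for x y
    using that R[of "collapse (p div 2) x" "collapse (p div 2) y"] assms(2)
    unfolding extend_rel_def insert_point_def double_point_def collapse_def
    by (cases "even p") (auto split: if_splits elim!: oddE)
  moreover have "equivp (extend_rel p R)" using eq by (simp add: extend_rel_def equivp_collapse_skip)
  ultimately show ?thesis by (simp add: partition_rel_def)
qed

section \<open>Commuting cups and counting normal forms\<close>

lemma collapse_collapse: "i \<le> j \<Longrightarrow> collapse i (collapse (Suc j) x) = collapse j (collapse i x)"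
  and collapse_low: "i \<le> j \<Longrightarrow> collapse j i = i"
  and collapse_high: "i \<le> j \<Longrightarrow> collapse i (Suc j) = j"
  and collapse_eq_low_iff: "i < j \<Longrightarrow> collapse j x = i \<longleftrightarrow> x = i" "i < j \<Longrightarrow> i = collapse j x \<longleftrightarrow> i = x"
  and collapse_eq_high_iff:
    "i \<le> j \<Longrightarrow> x \<noteq> i \<or> i < j \<Longrightarrow> collapse i x = j \<longleftrightarrow> x = Suc j"
    "i \<le> j \<Longrightarrow> x \<noteq> i \<or> i < j \<Longrightarrow> j = collapse i x \<longleftrightarrow> x = Suc j"
  by (auto simp: collapse_def)

text \<open>A cup adds two strands, so before the cup at \<open>p\<close> is inserted the one at
  \<open>q\<close> has position \<open>q - 2\<close>. The four parity cases reduce to the way two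
  \<open>collapse\<close> maps commute.\<close>

lemma extend_rel_commute:
  assumes "q \<ge> p + 2"
  shows "extend_rel q (extend_rel p R) = extend_rel p (extend_rel (q - 2) R)"
proof -
  obtain i where i: "p = 2 * i \<or> p = Suc (2 * i)" by (metis oddE evenE Suc_eq_plus1)
  obtain j where j: "q - 2 = 2 * j \<or> q - 2 = Suc (2 * j)" by (metis oddE evenE Suc_eq_plus1)
  have q: "even (q - 2) = even q" "(q - 2) div 2 = j" "q div 2 = Suc j" "p div 2 = i"
    using i j assms by auto
  show ?thesis
  proof (cases "even p"; cases "even q")
    assume e: "even p" "even q"
    then have ij: "i \<le> j" using i j assms by auto
    show ?thesis
    proof (intro ext)
      fix x y
      show "extend_rel q (extend_rel p R) x y = extend_rel p (extend_rel (q - 2) R) x y"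
        using e ij unfolding extend_rel_def q
        by (cases "x = i"; cases "y = i"; cases "x = Suc j"; cases "y = Suc j")
           (simp_all add: insert_point_def collapse_collapse collapse_low collapse_eq_low_iff collapse_high collapse_eq_high_iff)
    qed
  next
    assume e: "even p" "odd q"
    then have ij: "i \<le> j" using i j assms by auto
    show ?thesis
    proof (intro ext)
      fix x y
      show "extend_rel q (extend_rel p R) x y = extend_rel p (extend_rel (q - 2) R) x y"
        using e ij unfolding extend_rel_def q
        by (cases "x = i"; cases "y = i")
           (simp_all add: insert_point_def double_point_def collapse_collapse collapse_low collapse_eq_low_iff)
    qed
  next
    assume e: "odd p" "even q"
    \<comment> \<open>Parity makes the inequality strict, so the singleton inserted at
      \<open>Suc j\<close> cannot fall between the twins \<open>i\<close> and
      \<open>Suc i\<close>.\<close>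
    then have ij: "i < j" "i \<le> j" using i j assms by presburger+
    show ?thesis
    proof (intro ext)
      fix x y
      show "extend_rel q (extend_rel p R) x y = extend_rel p (extend_rel (q - 2) R) x y"
        using e ij unfolding extend_rel_def q
        by (cases "x = Suc j"; cases "y = Suc j")
           (simp_all add: insert_point_def double_point_def collapse_collapse collapse_high collapse_eq_high_iff)
    qed
  next
    assume e: "odd p" "odd q"
    then have ij: "i \<le> j" using i j assms by auto
    show ?thesis using e ij unfolding extend_rel_def q
      by (intro ext) (simp add: double_point_def collapse_collapse)
  qed
qed

text \<open>The second argument is the position of the last cup, set to 0 for the one-point
  partition. The position sequences start at 0 and rise by at most one per step: they are the area
  sequences of Dyck paths.\<close>

inductive normal_form :: "nat \<Rightarrow> nat \<Rightarrow> (nat \<Rightarrow> nat \<Rightarrow> bool) \<Rightarrow> bool" where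
  base: "normal_form (Suc 0) 0 (=)"
| step: "normal_form n r R \<Longrightarrow> p \<le> Suc r \<Longrightarrow> normal_form (Suc n) p (extend_rel p R)"

lemma normal_form_bound: "normal_form n p R \<Longrightarrow> p < n"
  by (induction rule: normal_form.induct) auto

lemma partition_rel_normal: "normal_form n p R \<Longrightarrow> partition_rel n R"
proof (induction rule: normal_form.induct)
  case base
  show ?case by (simp add: partition_rel_def identity_equivp)
next
  case (step n r R p)
  then show ?case using normal_form_bound[OF step.hyps(1)] by (intro partition_rel_extend) auto
qed

text \<open>A cup at \<open>q\<close> beyond \<open>Suc p\<close> is moved below the last cup, where
  it has position \<open>q - 2\<close>, and the cup at \<open>p\<close> is put back on top. The
  bound \<open>min q s\<close> shows that \<open>p\<close> is then still admissible.\<close>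

lemma normal_form_extend:
  assumes "normal_form n s R" "q \<le> 2 * n"
  shows "\<exists>r\<ge>min q s. normal_form (Suc n) r (extend_rel q R)"
  using assms
proof (induction arbitrary: q rule: normal_form.induct)
  case base
  show ?case
  proof (cases "q = 2")
    case True
    \<comment> \<open>Position 2 exceeds the admissible bound, but a singleton after the only point
      gives the same discrete relation as one before it.\<close>
    have "extend_rel 2 (=) = extend_rel 0 ((=) :: nat \<Rightarrow> nat \<Rightarrow> bool)"
      by (intro ext) (auto simp: extend_rel_def insert_point_def collapse_def)
    then show ?thesis using normal_form.step[OF normal_form.base, of 0] True by auto
  next
    case False
    then show ?thesis using normal_form.step[OF normal_form.base, of q] base by auto
  qed
next
  case (step n r R p)
  show ?case
  proof (cases "q \<le> Suc p")
    case True
    then show ?thesis using normal_form.step[OF normal_form.step[OF step.hyps], of q] by (intro exI[of _ q]) auto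
  next
    case False
    obtain r' where r': "r' \<ge> min (q - 2) r" "normal_form (Suc n) r' (extend_rel (q - 2) R)"
      using step.IH[of "q - 2"] step.prems by fastforce
    have "normal_form (Suc (Suc n)) p (extend_rel p (extend_rel (q - 2) R))"
      by (rule normal_form.step[OF r'(2)]) (use r'(1) step.hyps(2) False in auto)
    then show ?thesis using extend_rel_commute[of p q R] False by auto
  qed
qed

definition normal_forms :: "nat \<Rightarrow> nat \<Rightarrow> (nat \<Rightarrow> nat \<Rightarrow> bool) set" where
  "normal_forms n p = {R. \<exists>r\<ge>p. normal_form n r R}"

text \<open>Removing a last cup at exactly \<open>p\<close> leaves a last position of at least
  \<open>p - 1\<close>. For \<open>p = 0\<close> the truncated difference 0 imposes no restriction,
  as it should.\<close>

lemma normal_forms_Suc: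
  assumes "n > 0"
  shows "normal_forms (Suc n) p \<subseteq> normal_forms (Suc n) (Suc p) \<union> extend_rel p ` normal_forms n (p - 1)"
proof
  fix R assume "R \<in> normal_forms (Suc n) p"
  then obtain r where r: "r \<ge> p" "normal_form (Suc n) r R" by (auto simp: normal_forms_def)
  show "R \<in> normal_forms (Suc n) (Suc p) \<union> extend_rel p ` normal_forms n (p - 1)"
  proof (cases "r = p")
    case True
    from r(2) show ?thesis
    proof cases
      case base
      then show ?thesis using assms by simp
    next
      case (step s R')
      then have "R' \<in> normal_forms n (p - 1)"
        using True unfolding normal_forms_def by (intro CollectI exI[of _ s]) auto
      then show ?thesis using step True by auto
    qed
  next
    case False
    then show ?thesis using r by (auto simp: normal_forms_def)
  qed
qed

text \<open>
  The bounds are ballot numbers: Pascal's rule matches the recursion of \<open>normal_forms_Suc\<close>.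
\<close>

lemma card_normal_forms:
  assumes "n > 0" "p \<le> n"
  shows "finite (normal_forms n p) \<and> real (card (normal_forms n p)) \<le>
    real ((2 * n - p - 1) choose n) - real ((2 * n - p - 1) choose Suc n)"
  using assms
proof (induction n arbitrary: p rule: nat_induct_non_zero)
  case 1
  have no_zero: False if "normal_form 0 r R" for r R using normal_form_bound[OF that] by simp
  have "normal_forms 1 p \<subseteq> {(=)}"
    by (auto simp: normal_forms_def elim: normal_form.cases dest: no_zero)
  moreover have "p = 1 \<Longrightarrow> normal_forms 1 p = {}"
    by (auto simp: normal_forms_def dest!: normal_form_bound)
  moreover have "p = 0 \<or> p = 1" using 1 by auto
  ultimately show ?case by (auto dest: finite_subset card_mono[rotated])
next
  case (Suc n)
  \<comment> \<open>Downward induction on \<open>p\<close> from \<open>Suc n\<close>, where no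
    normal form remains.\<close>
  from Suc.prems show ?case
  proof (induction p rule: inc_induct)
    case base
    have "normal_forms (Suc n) (Suc n) = {}" by (auto simp: normal_forms_def dest!: normal_form_bound)
    then show ?case by (simp add: binomial_eq_0)
  next
    case (step p)
    have fin: "finite (normal_forms (Suc n) (Suc p))" "finite (normal_forms n (p - 1))"
      using step Suc.IH[of "p - 1"] by auto
    have sub: "normal_forms (Suc n) p \<subseteq> normal_forms (Suc n) (Suc p) \<union> extend_rel p ` normal_forms n (p - 1)"
      by (rule normal_forms_Suc) fact
    have "card (normal_forms (Suc n) p) \<le> card (normal_forms (Suc n) (Suc p) \<union> extend_rel p ` normal_forms n (p - 1))"
      by (rule card_mono) (use sub fin in auto)
    also have "\<dots> \<le> card (normal_forms (Suc n) (Suc p)) + card (normal_forms n (p - 1))"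
      by (rule order_trans[OF card_Un_le]) (use fin card_image_le in auto)
    finally have "real (card (normal_forms (Suc n) p)) \<le>
        real (card (normal_forms (Suc n) (Suc p))) + real (card (normal_forms n (p - 1)))"
      using of_nat_mono by fastforce
    also have "\<dots> \<le> (real ((2 * Suc n - Suc p - 1) choose Suc n) - real ((2 * Suc n - Suc p - 1) choose Suc (Suc n)))
        + (real ((2 * n - (p - 1) - 1) choose n) - real ((2 * n - (p - 1) - 1) choose Suc n))"
      using step Suc.IH[of "p - 1"] by (intro add_mono) auto
    also have "\<dots> = real ((2 * Suc n - p - 1) choose Suc n) - real ((2 * Suc n - p - 1) choose Suc (Suc n))"
    proof (cases p)
      case 0
      \<comment> \<open>As \<open>p - 1\<close> truncates to 0, Pascal's rule does not fit directly;
        the symmetry of the two middle binomials of row \<open>2 * n - 1\<close> closes the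
        gap.\<close>
      obtain m where m: "n = Suc m" using \<open>n > 0\<close> by (cases n) auto
      have "(Suc (2 * m) choose m) = (Suc (2 * m) choose Suc m)"
        using binomial_symmetric[of m "Suc (2 * m)"] by (simp add: Suc_diff_le)
      then show ?thesis by (simp add: 0 m)
    next
      case (Suc q)
      obtain m where m: "2 * n - q = Suc m" using Suc step by (cases "2 * n - q") auto
      have e: "2 * Suc n - p - 1 = Suc m" "2 * Suc n - Suc p - 1 = m" "2 * n - (p - 1) - 1 = m"
        using m Suc by auto
      show ?thesis unfolding e by simp
    qed
    finally show ?case using finite_subset[OF sub] fin by auto
  qed
qed

section \<open>The span of the normal-form rows\<close>

definition spanned :: "nat \<Rightarrow> ((nat \<Rightarrow> nat \<Rightarrow> bool) \<Rightarrow> real) \<Rightarrow> bool" where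
  "spanned n g \<longleftrightarrow> (\<exists>c. \<forall>Q. partition_rel n Q \<longrightarrow> g Q = (\<Sum>N\<in>normal_forms n 0. c N * acyclic_entry N Q))"

lemma spanned_cong:
  "spanned n g \<Longrightarrow> (\<And>Q. partition_rel n Q \<Longrightarrow> h Q = g Q) \<Longrightarrow> spanned n h"
  unfolding spanned_def by fastforce

lemma spanned_add:
  assumes "spanned n g" "spanned n h" shows "spanned n (\<lambda>Q. g Q + h Q)"
proof -
  obtain c d where "\<forall>Q. partition_rel n Q \<longrightarrow> g Q = (\<Sum>N\<in>normal_forms n 0. c N * acyclic_entry N Q)"
    "\<forall>Q. partition_rel n Q \<longrightarrow> h Q = (\<Sum>N\<in>normal_forms n 0. d N * acyclic_entry N Q)"
    using assms unfolding spanned_def by blast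
  then show ?thesis unfolding spanned_def
    by (intro exI[of _ "\<lambda>N. c N + d N"]) (simp add: distrib_right sum.distrib)
qed

lemma spanned_scale:
  assumes "spanned n g" shows "spanned n (\<lambda>Q. k * g Q)"
proof -
  obtain c where "\<forall>Q. partition_rel n Q \<longrightarrow> g Q = (\<Sum>N\<in>normal_forms n 0. c N * acyclic_entry N Q)"
    using assms unfolding spanned_def by blast
  then show ?thesis unfolding spanned_def
    by (intro exI[of _ "\<lambda>N. k * c N"]) (simp add: sum_distrib_left mult.assoc)
qed

lemma spanned_diff:
  assumes "spanned n g" "spanned n h" shows "spanned n (\<lambda>Q. g Q - h Q)"
  using spanned_add[OF assms(1) spanned_scale[OF assms(2), of "- 1"]] by simp

lemma spanned_sum:
  assumes "finite A" "\<And>a. a \<in> A \<Longrightarrow> spanned n (g a)" shows "spanned n (\<lambda>Q. \<Sum>a\<in>A. g a Q)"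
  using assms
proof (induction rule: finite_induct)
  case empty
  show ?case unfolding spanned_def by (intro exI[of _ "\<lambda>_. 0"]) simp
next
  case (insert a A)
  then show ?case using spanned_add by simp
qed

lemma spanned_normal:
  assumes "N \<in> normal_forms n 0" "n > 0" shows "spanned n (acyclic_entry N)"
  unfolding spanned_def
  using assms card_normal_forms[of n 0]
  by (intro exI[of _ "\<lambda>M. if M = N then 1 else 0"]) (simp add: if_distrib[of "\<lambda>c. c * _"] cong: if_cong)

text \<open>The coefficients of \<open>R\<close> serve again: the linear map of
  \<open>acyclic_entry_extend\<close> carries the combination to extended normal forms, which are
  normal forms by \<open>normal_form_extend\<close>.\<close>

lemma spanned_extend:
  assumes R: "partition_rel n R" and n: "n > 0" and sp: "spanned n (acyclic_entry R)" and p: "p \<le> 2 * n"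
  shows "spanned (Suc n) (acyclic_entry (extend_rel p R))"
proof -
  obtain c where c: "\<And>Q. partition_rel n Q \<Longrightarrow> acyclic_entry R Q = (\<Sum>N\<in>normal_forms n 0. c N * acyclic_entry N Q)"
    using sp unfolding spanned_def by blast
  show ?thesis
  proof (rule spanned_cong)
    show "spanned (Suc n) (\<lambda>Q. \<Sum>N\<in>normal_forms n 0. c N * acyclic_entry (extend_rel p N) Q)"
    proof (intro spanned_sum spanned_scale)
      show "finite (normal_forms n 0)" using card_normal_forms n by blast
      show "spanned (Suc n) (acyclic_entry (extend_rel p N))" if "N \<in> normal_forms n 0" for N
        using that normal_form_extend[OF _ p] by (intro spanned_normal) (auto simp: normal_forms_def)
    qed
    fix Q assume Q: "partition_rel (Suc n) Q"
    have "acyclic_entry (extend_rel p N) Q =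
      (if odd p \<and> Q (p div 2) (Suc (p div 2)) then 0 else acyclic_entry N (restrict_rel p Q))"
      if "partition_rel n N" for N
      using Q that by (intro acyclic_entry_extend) (auto simp: partition_rel_def)
    then show "acyclic_entry (extend_rel p R) Q = (\<Sum>N\<in>normal_forms n 0. c N * acyclic_entry (extend_rel p N) Q)"
      using R c[OF partition_rel_restrict[OF Q p]] partition_rel_normal
      by (auto simp: normal_forms_def intro!: sum.neutral sum.cong)
  qed
qed

definition isolate :: "nat \<Rightarrow> (nat \<Rightarrow> nat \<Rightarrow> bool) \<Rightarrow> nat \<Rightarrow> nat \<Rightarrow> bool" where
  "isolate j R x y \<longleftrightarrow> x = y \<or> x \<noteq> j \<and> y \<noteq> j \<and> R x y"

lemma partition_rel_isolate:
  assumes "partition_rel n R" shows "partition_rel n (isolate j R)"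
proof -
  have R: "equivp R" using assms by (simp add: partition_rel_def)
  have "equivp (isolate j R)"
  proof (intro equivpI reflpI sympI transpI)
    show "isolate j R y x" if "isolate j R x y" for x y
      using that equivp_symp[OF R, of x y] by (auto simp: isolate_def)
    show "isolate j R x z" if "isolate j R x y" "isolate j R y z" for x y z
      using that equivp_transp[OF R, of x y z] by (auto simp: isolate_def)
  qed (simp add: isolate_def)
  then show ?thesis using assms by (auto simp: partition_rel_def isolate_def)
qed

lemma merge_isolate:
  assumes R: "equivp R" and "R a c" "a \<noteq> c"
  shows "merge a c (isolate c R) = R"
proof (intro ext)
  fix x y
  have "R x a = R x c" for x using assms(2) equivp_transp[OF R] equivp_symp[OF R] by metis
  moreover have "R a y = R c y" for y using assms(2) equivp_transp[OF R] equivp_symp[OF R] by metis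
  moreover have "R x a \<Longrightarrow> R a y \<Longrightarrow> R x y" using equivp_transp[OF R] by blast
  ultimately show "merge a c (isolate c R) x y = R x y"
    using assms(3) equivp_reflp[OF R] by (cases "x = c"; cases "y = c") (auto simp: merge_def isolate_def)
qed

text \<open>
  The induction is on the distance of two related points. If they are not adjacent, the uncrossing
  relation for the right point \<open>j\<close> and its left neighbour \<open>k\<close> replaces the row by minus the row with
  \<open>j\<close> and \<open>k\<close> swapped, up to rows in which \<open>j\<close> or \<open>k\<close> is isolated or both are related.
\<close>

lemma spanned_related_pair:
  assumes n: "n > 0" and IH: "\<And>R. partition_rel n R \<Longrightarrow> spanned n (acyclic_entry R)"
    and "partition_rel (Suc n) R" "R i (i + d)" "d > 0" "i + d \<le> n"
  shows "spanned (Suc n) (acyclic_entry R)"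
  using assms(3-)
proof (induction d arbitrary: R)
  case 0
  then show ?case by simp
next
  case (Suc e)
  have isolated: "spanned (Suc n) (acyclic_entry R)"
    if "partition_rel (Suc n) R" "k \<le> n" "\<And>y. R k y \<Longrightarrow> y = k" for R k
  proof -
    have "extend_rel (2 * k) (delete_point k R) = R"
      using that insert_delete_point[of R k] by (simp add: extend_rel_def partition_rel_def)
    then show ?thesis
      using spanned_extend[OF _ n IH, of "delete_point k R" "2 * k"] partition_rel_delete[OF that(1,2)] that(2) by simp
  qed
  have adjacent: "spanned (Suc n) (acyclic_entry R)"
    if "partition_rel (Suc n) R" "k < n" "R k (Suc k)" for R k
  proof -
    have "extend_rel (Suc (2 * k)) (delete_point k R) = R"
      using that double_delete_point[of R k] by (simp add: extend_rel_def partition_rel_def)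
    then show ?thesis
      using spanned_extend[OF _ n IH, of "delete_point k R" "Suc (2 * k)"] partition_rel_delete[OF that(1)] that(2) by simp
  qed
  have R: "equivp R" using Suc.prems(1) by (simp add: partition_rel_def)
  define k j where "k = i + e" and "j = Suc k"
  have kn: "k < n" "j \<le> n" using Suc.prems by (auto simp: k_def j_def)
  have Rij: "R i j" using Suc.prems by (simp add: k_def j_def)
  consider "R k j" | "\<And>y. R k y \<Longrightarrow> y = k" | k' where "\<not> R k j" "R k k'" "k' \<noteq> k" by blast
  then show ?case
  proof cases
    case 1
    then show ?thesis using adjacent[OF Suc.prems(1) kn(1)] by (simp add: j_def)
  next
    case 2
    then show ?thesis using isolated[OF Suc.prems(1), of k] kn by simp
  next
    case 3
    have k'n: "k' \<le> n" using 3 Suc.prems(1) unfolding partition_rel_def by (metis less_Suc_eq_le)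
    have ik: "\<not> R i k" using 3(1) Rij equivp_transp[OF R] equivp_symp[OF R] by metis
    have ik': "\<not> R i k'" using ik 3(2) equivp_transp[OF R] equivp_symp[OF R] by metis
    have "e > 0" using ik equivp_reflp[OF R, of i] by (cases e) (auto simp: k_def)
    have ne: "i \<noteq> k" "i \<noteq> k'" "i \<noteq> j" "k' \<noteq> j" "j \<noteq> k"
      using ik' 3 \<open>e > 0\<close> equivp_reflp[OF R, of i] by (auto simp: j_def k_def)
    \<comment> \<open>Cutting \<open>j\<close> and \<open>k\<close> out of their blocks puts
      \<open>i\<close>, \<open>k'\<close>, \<open>j\<close>, \<open>k\<close> into four different
      blocks. They play \<open>a\<close>, \<open>b\<close>, \<open>c\<close>, \<open>d\<close> in
      \<open>uncrossing\<close>, whose left side is then the row of \<open>R\<close>.\<close>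
    define R0 where "R0 = isolate j (isolate k R)"
    have P0: "partition_rel (Suc n) R0" unfolding R0_def by (intro partition_rel_isolate Suc.prems)
    have P1: "partition_rel (Suc n) (isolate k R)" by (intro partition_rel_isolate Suc.prems)
    have E0: "equivp R0" using P0 by (simp add: partition_rel_def)
    have R_eq: "R = merge k' k (merge i j R0)"
    proof -
      have "merge i j R0 = isolate k R" unfolding R0_def
        by (rule merge_isolate) (use P1 Rij ne in \<open>auto simp: partition_rel_def isolate_def\<close>)
      then show ?thesis using merge_isolate[OF R, of k' k] 3 equivp_symp[OF R] by metis
    qed
    have R0: "\<not> R0 i k'" "\<not> R0 i j" "\<not> R0 i k" "\<not> R0 k' j" "\<not> R0 k' k" "\<not> R0 j k"
      using ne 3 ik' by (auto simp: R0_def isolate_def)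
    have iso: "R0 k y \<longleftrightarrow> y = k" "R0 j y \<longleftrightarrow> y = j" for y
      using ne by (auto simp: R0_def isolate_def)
    have P: "partition_rel (Suc n) (merge a b M)" if "partition_rel (Suc n) M"
      "a \<in> {i, j, k, k'}" "b \<in> {i, j, k, k'}" for a b M
      using that kn k'n Suc.prems by (intro partition_rel_merge) (auto simp: k_def j_def)
    have mono: "M x y \<Longrightarrow> merge a b M x y" for M a b and x y :: nat by (simp add: merge_def)
    have kj: "merge j k R0 k j" using E0 by (simp add: merge_def equivp_reflp)
    \<comment> \<open>In \<open>t1\<close> and \<open>t2\<close> one of \<open>k\<close>,
      \<open>j\<close> is a singleton; in \<open>t3\<close> and \<open>t4\<close> these neighbours
      are related.\<close>
    have t1: "spanned (Suc n) (acyclic_entry (merge k' j (merge i k' R0)))"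
      by (rule isolated[of _ k]) (use P P0 kn ne 3 iso in \<open>auto simp: merge_def\<close>)
    have t2: "spanned (Suc n) (acyclic_entry (merge k' k (merge i k' R0)))"
      by (rule isolated[of _ j]) (use P P0 kn ne 3 iso in \<open>auto simp: merge_def\<close>)
    have t3: "spanned (Suc n) (acyclic_entry (merge a b (merge j k R0)))"
      if "a \<in> {i, j, k, k'}" "b \<in> {i, j, k, k'}" for a b
      by (rule adjacent[of _ k]) (use that P P0 kn mono[of "merge j k R0" k j, OF kj] in \<open>auto simp: j_def\<close>)
    have t4: "spanned (Suc n) (acyclic_entry (merge i k' (merge i k (merge j k R0))))"
      by (rule adjacent[of _ k]) (use P P0 kn mono[of "merge i k (merge j k R0)" k j] mono[of "merge j k R0" k j, OF kj] in \<open>auto simp: j_def\<close>)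
    \<comment> \<open>The swapped row relates \<open>i\<close> to \<open>k = i + e\<close>, one step
      closer, so the induction hypothesis applies.\<close>
    have t5: "spanned (Suc n) (acyclic_entry (merge k' j (merge i k R0)))"
    proof (rule Suc.IH)
      show "merge k' j (merge i k R0) i (i + e)"
        using mono[of "merge i k R0" i k] merge_related[OF E0, of i k] by (simp add: k_def)
    qed (use P P0 \<open>e > 0\<close> Suc.prems in auto)
    show ?thesis
      by (rule spanned_cong[OF spanned_diff[OF spanned_diff[OF spanned_diff[OF spanned_add[OF spanned_add[OF
            spanned_add[OF t1 t2] t3[of i k]] t3[of k' k]] t3[of i k']] t5] t4]])
         (use R0 E0 in \<open>auto simp: partition_rel_def R_eq intro!: uncrossing\<close>)
  qed
qed

text \<open>Without a related pair the partition is discrete, and the singleton 0 can be split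
  off.\<close>

lemma spanned_partition_rel:
  assumes "n > 0" "partition_rel n R"
  shows "spanned n (acyclic_entry R)"
  using assms
proof (induction n arbitrary: R rule: nat_induct_non_zero)
  case 1
  have "R x y \<longleftrightarrow> x = y" for x y using 1 equivp_reflp[of R] unfolding partition_rel_def by auto
  then have "R = (=)" by (intro ext) simp
  then show ?case using spanned_normal[of "(=)" 1] normal_form.base by (auto simp: normal_forms_def)
next
  case (Suc n)
  show ?case
  proof (cases "\<exists>i j. R i j \<and> i < j")
    case True
    then obtain i d where "R i (i + d)" "d > 0" by (metis less_imp_add_positive)
    moreover from this have "i + d \<le> n" using Suc.prems unfolding partition_rel_def
      by (metis add_eq_self_zero less_Suc_eq_le less_numeral_extra(3))
    ultimately show ?thesis using spanned_related_pair[of n] Suc by blast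
  next
    case False
    have eq: "equivp R" using Suc.prems by (simp add: partition_rel_def)
    have "R 0 y \<Longrightarrow> y = 0" for y using False by (cases "y = 0") auto
    then have "extend_rel 0 (delete_point 0 R) = R"
      using insert_delete_point[OF eq, of 0] by (simp add: extend_rel_def)
    then show ?thesis
      using spanned_extend[of n "delete_point 0 R" 0] Suc partition_rel_delete[OF Suc.prems, of 0] by simp
  qed
qed

section \<open>Cycles in glued forests\<close>

text \<open>Minimum degree two for an edge set, a loop counting twice. Unlike an ordered cycle, such
  a set is easily split between the two sides of a glue.\<close>

definition edge_core :: "('v, 'e) multigraph \<Rightarrow> 'e set \<Rightarrow> bool" where
  "edge_core G T \<longleftrightarrow> T \<subseteq> edges G \<and> T \<noteq> {} \<and>
     (\<forall>e\<in>T. \<forall>v\<in>ends G e. ends G e = {v} \<or> (\<exists>e'\<in>T. e' \<noteq> e \<and> v \<in> ends G e'))"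

lemma edge_core_of_cycle:
  assumes "is_cycle G vs es" shows "edge_core G (set es)"
proof -
  define n where "n = length vs"
  have n: "n > 0" "length es = n" "distinct es" "set es \<subseteq> edges G"
    "\<And>i. i < n \<Longrightarrow> ends G (es ! i) = {vs ! i, vs ! (Suc i mod n)}"
    using assms by (auto simp: is_cycle_def n_def)
  have "ends G e = {v} \<or> (\<exists>e'\<in>set es. e' \<noteq> e \<and> v \<in> ends G e')" if e: "e \<in> set es" "v \<in> ends G e" for e v
  proof -
    obtain i where i: "i < n" "e = es ! i" using e(1) n(2) by (metis in_set_conv_nth)
    show ?thesis
    proof (cases "n = 1")
      case True
      then show ?thesis using e i n(5)[of i] by auto
    next
      case False
      obtain j where j: "j < n" "j \<noteq> i" "v \<in> ends G (es ! j)"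
      proof (cases "v = vs ! i")
        case True
        \<comment> \<open>The vertex \<open>vs ! i\<close> is shared with the cyclically preceding
          edge.\<close>
        define j where "j = (if i = 0 then n - 1 else i - 1)"
        have "j < n" "j \<noteq> i" "Suc j mod n = i" using i False n(1) by (auto simp: j_def)
        then show thesis using that[of j] n(5)[of j] True by simp
      next
        case F: False
        then have v: "v = vs ! (Suc i mod n)" using e i n(5)[of i] by auto
        have "Suc i mod n < n" "Suc i mod n \<noteq> i"
          using False n(1) i(1) by (auto simp: mod_Suc)
        then show thesis using that[of "Suc i mod n"] n(5)[of "Suc i mod n"] v by simp
      qed
      then have "es ! j \<in> set es" "es ! j \<noteq> e" using i n(2,3) by (auto simp: nth_eq_iff_index_eq)
      then show ?thesis using j by blast
    qed
  qed
  then show ?thesis unfolding edge_core_def using n by auto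
qed

text \<open>Loops aside, one can walk through \<open>T\<close> forever without using an edge twice
  in a row. Finiteness forces a vertex to recur, and a shortest return is a cycle.\<close>

lemma cycle_of_edge_core:
  assumes G: "is_multigraph G" and T: "edge_core G T"
  shows "contains_cycle G"
proof (cases "\<exists>e\<in>T. \<exists>v. ends G e = {v}")
  case True
  then obtain e v where "e \<in> T" "ends G e = {v}" by blast
  then have "is_cycle G [v] [e]" using G T unfolding is_cycle_def is_multigraph_def edge_core_def by auto
  then show ?thesis unfolding contains_cycle_def by blast
next
  case False
  have T': "T \<subseteq> edges G" "T \<noteq> {}" using T by (auto simp: edge_core_def)
  have two: "\<exists>w. ends G e = {v, w}" if "e \<in> T" "v \<in> ends G e" for e v
  proof -
    have "card (ends G e) \<in> {1, 2}" using G T' that unfolding is_multigraph_def by blast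
    then have "card (ends G e) = 2" using False that by (auto simp: card_1_singleton_iff)
    then show ?thesis using that(2) by (auto simp: card_2_iff)
  qed
  have next_edge: "\<exists>e' w. e' \<in> T \<and> e' \<noteq> e \<and> ends G e' = {v, w}" if "e \<in> T" "v \<in> ends G e" for e v
    using T that False two unfolding edge_core_def by metis
  \<comment> \<open>The state of the walk is the edge just used together with the end at which the
    walk arrives.\<close>
  have "\<exists>f. \<forall>k::nat. (fst (f k) \<in> T \<and> snd (f k) \<in> ends G (fst (f k))) \<and>
      (fst (f (Suc k)) \<noteq> fst (f k) \<and> ends G (fst (f (Suc k))) = {snd (f k), snd (f (Suc k))})"
  proof (rule dependent_nat_choice)
    obtain e where "e \<in> T" using T' by blast
    moreover have "ends G e \<noteq> {}" using G T' calculation unfolding is_multigraph_def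
      by (metis card.empty insert_iff one_neq_zero singletonD subsetD zero_neq_numeral)
    ultimately show "\<exists>x. fst x \<in> T \<and> snd x \<in> ends G (fst x)" by auto
    show "\<exists>y. (fst y \<in> T \<and> snd y \<in> ends G (fst y)) \<and> fst y \<noteq> fst x \<and> ends G (fst y) = {snd x, snd y}"
      if x: "fst x \<in> T \<and> snd x \<in> ends G (fst x)" for x and k :: nat
    proof -
      obtain e' w where "e' \<in> T" "e' \<noteq> fst x" "ends G e' = {snd x, w}" using next_edge x by blast
      then show ?thesis by (intro exI[of _ "(e', w)"]) auto
    qed
  qed
  then obtain f where f: "\<And>k::nat. fst (f k) \<in> T" "\<And>k. snd (f k) \<in> ends G (fst (f k))"
    "\<And>k. fst (f (Suc k)) \<noteq> fst (f k)" "\<And>k. ends G (fst (f (Suc k))) = {snd (f k), snd (f (Suc k))}" by blast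
  define w where "w k = snd (f k)" for k
  define e where "e k = fst (f (Suc k))" for k
  have eT: "e k \<in> T" and ends_e: "ends G (e k) = {w k, w (Suc k)}" and e_neq: "e (Suc k) \<noteq> e k" for k
    using f by (auto simp: e_def w_def)
  have w: "w k \<in> verts G" for k
    using G eT[of k] ends_e[of k] T' unfolding is_multigraph_def by blast
  have "finite (range w)"
    using G w unfolding is_multigraph_def by (meson finite_subset image_subsetI)
  then have "\<not> inj w" using finite_imageD[of w UNIV] by auto
  then obtain a b where "w a = w b" "a < b" unfolding inj_def by (metis nat_neq_iff)
  then have ex: "\<exists>d>0. \<exists>i. w i = w (i + d)" by (metis less_imp_add_positive)
  \<comment> \<open>Minimality over all starting points makes the \<open>d\<close> vertices
    distinct. Two equal edges would then have to be consecutive, which the walk excludes.\<close>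
  define d where "d = (LEAST d. d > 0 \<and> (\<exists>i. w i = w (i + d)))"
  have d: "d > 0 \<and> (\<exists>i. w i = w (i + d))" unfolding d_def by (rule LeastI_ex) (use ex in blast)
  then obtain i where i: "w (i + d) = w i" by metis
  have w_neq: "w (i + a) \<noteq> w (i + b)" if "a < b" "b < d" for a b
  proof
    assume "w (i + a) = w (i + b)"
    then have "w (i + a) = w ((i + a) + (b - a))" using that by simp
    then have "d \<le> b - a" unfolding d_def using that by (intro Least_le conjI exI[of _ "i + a"]) simp_all
    then show False using that by simp
  qed
  have e_distinct: "e (i + a) \<noteq> e (i + b)" if "a < b" "b < d" for a b
  proof
    assume eq: "e (i + a) = e (i + b)"
    then have "w (i + b) \<in> {w (i + a), w (i + Suc a)}" using ends_e[of "i + a"] ends_e[of "i + b"] by auto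
    then have "w (i + Suc a) = w (i + b)" using w_neq[OF that] by auto
    then have "b = Suc a" using w_neq[of "Suc a" b] that by (cases "Suc a = b") auto
    then show False using eq e_neq[of "i + a"] by simp
  qed
  have "is_cycle G (map (\<lambda>k. w (i + k)) [0..<d]) (map (\<lambda>k. e (i + k)) [0..<d])"
    unfolding is_cycle_def
  proof (intro conjI)
    show "distinct (map (\<lambda>k. w (i + k)) [0..<d])" "distinct (map (\<lambda>k. e (i + k)) [0..<d])"
      using w_neq e_distinct by (auto simp: distinct_map inj_on_def) (metis nat_neq_iff)+
    show "\<forall>k<length (map (\<lambda>k. w (i + k)) [0..<d]).
        ends G (map (\<lambda>k. e (i + k)) [0..<d] ! k) =
          {map (\<lambda>k. w (i + k)) [0..<d] ! k,
           map (\<lambda>k. w (i + k)) [0..<d] ! (Suc k mod length (map (\<lambda>k. w (i + k)) [0..<d]))}"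
    proof (intro allI impI)
      fix k assume "k < length (map (\<lambda>k. w (i + k)) [0..<d])"
      then have k: "k < d" by simp
      then have m: "Suc k mod d < d" by simp
      have "w (i + Suc k mod d) = w (Suc (i + k))"
        using k i by (cases "Suc k = d") auto
      then show "ends G (map (\<lambda>k. e (i + k)) [0..<d] ! k) =
          {map (\<lambda>k. w (i + k)) [0..<d] ! k,
           map (\<lambda>k. w (i + k)) [0..<d] ! (Suc k mod length (map (\<lambda>k. w (i + k)) [0..<d]))}"
        using k m ends_e[of "i + k"] by simp
    qed
  qed (use d w eT T' in auto)
  then show ?thesis unfolding contains_cycle_def by blast
qed

lemma contains_cycle_iff_edge_core:
  "is_multigraph G \<Longrightarrow> contains_cycle G \<longleftrightarrow> (\<exists>T. edge_core G T)"
  using edge_core_of_cycle cycle_of_edge_core unfolding contains_cycle_def by metis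

text \<open>Deleting the single edge at a deficient \<open>x\<close> can make only its other end
  deficient, and that end lies on a further edge, so the set stays nonempty. The process must stop
  at an edge core.\<close>

lemma edge_core_if_one_deficient:
  assumes G: "is_multigraph G" and "T \<subseteq> edges G" "T \<noteq> {}"
    "\<And>e v. e \<in> T \<Longrightarrow> v \<in> ends G e \<Longrightarrow> v \<noteq> x \<Longrightarrow> ends G e = {v} \<or> (\<exists>e'\<in>T. e' \<noteq> e \<and> v \<in> ends G e')"
  shows "\<exists>T. edge_core G T"
  using assms(2-)
proof (induction "card T" arbitrary: T x rule: less_induct)
  case less
  have fin: "finite T" using G less.prems(1) finite_subset unfolding is_multigraph_def by blast
  show ?case
  proof (cases "edge_core G T")
    case True
    then show ?thesis by blast
  next
    case False
    then obtain e where e: "e \<in> T" "x \<in> ends G e" "ends G e \<noteq> {x}"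
      "\<And>e'. e' \<in> T \<Longrightarrow> x \<in> ends G e' \<Longrightarrow> e' = e"
      using less.prems unfolding edge_core_def by metis
    have "card (ends G e) \<in> {1, 2}" using G e less.prems(1) unfolding is_multigraph_def by blast
    then obtain y where y: "ends G e = {x, y}" "y \<noteq> x"
      using e(2,3) by (auto simp: card_1_singleton_iff card_2_iff doubleton_eq_iff)
    have ye: "ends G e \<noteq> {y}" using y by auto
    then obtain e1 where e1: "e1 \<in> T" "e1 \<noteq> e" using less.prems(3)[OF e(1), of y] y by auto
    show ?thesis
    proof (rule less.hyps[of "T - {e}" y])
      show "card (T - {e}) < card T" using fin e(1) by (metis card_Diff1_less)
      show "ends G e' = {v} \<or> (\<exists>e''\<in>T - {e}. e'' \<noteq> e' \<and> v \<in> ends G e'')"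
        if h: "e' \<in> T - {e}" "v \<in> ends G e'" "v \<noteq> y" for e' v
      proof -
        have "v \<noteq> x" using h e(4) by blast
        then have "v \<notin> ends G e" using y h by auto
        then show ?thesis using less.prems(3)[of e' v] h \<open>v \<noteq> x\<close> by blast
      qed
    qed (use less.prems e1 in auto)
  qed
qed

lemma ends_connected:
  assumes "is_multigraph G" "e \<in> edges G" "u \<in> ends G e" "v \<in> ends G e"
  shows "(u, v) \<in> (adjacency G)\<^sup>*"
proof (cases "u = v")
  case False
  have "card (ends G e) \<in> {1, 2}" using assms unfolding is_multigraph_def by blast
  then have "ends G e = {u, v}" using False assms(3,4) by (auto simp: card_1_singleton_iff card_2_iff)
  then show ?thesis using assms(2) by (auto simp: adjacency_def)
qed simp

text \<open>A tree with an edge has two leaves, hence one besides \<open>x\<close>: otherwise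
  \<open>x\<close> would be the only deficient vertex of \<open>T\<close> in its component, which
  gives a cycle.\<close>

lemma forest_leaf:
  assumes "is_forest G" "T \<subseteq> edges G" "e \<in> T" "x \<in> ends G e"
  obtains v e1 where "v \<noteq> x" "(x, v) \<in> (adjacency G)\<^sup>*" "e1 \<in> T" "v \<in> ends G e1" "ends G e1 \<noteq> {v}"
    "\<And>e'. e' \<in> T \<Longrightarrow> v \<in> ends G e' \<Longrightarrow> e' = e1"
proof -
  have G: "is_multigraph G" and nc: "\<not> (\<exists>T. edge_core G T)"
    using assms(1) contains_cycle_iff_edge_core unfolding is_forest_def by blast+
  define T' where "T' = {e\<in>T. \<forall>v\<in>ends G e. (x, v) \<in> (adjacency G)\<^sup>*}"
  have "e \<in> T'" using assms ends_connected[OF G] unfolding T'_def by blast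
  have "\<not> (\<forall>e v. e \<in> T' \<longrightarrow> v \<in> ends G e \<longrightarrow> v \<noteq> x \<longrightarrow> ends G e = {v} \<or> (\<exists>e'\<in>T'. e' \<noteq> e \<and> v \<in> ends G e'))"
    using edge_core_if_one_deficient[OF G, of T' x] nc assms(2) \<open>e \<in> T'\<close> unfolding T'_def by blast
  then obtain e1 v where h: "e1 \<in> T'" "v \<in> ends G e1" "v \<noteq> x" "ends G e1 \<noteq> {v}"
    "\<And>e'. e' \<in> T' \<Longrightarrow> v \<in> ends G e' \<Longrightarrow> e' = e1" by blast
  have xv: "(x, v) \<in> (adjacency G)\<^sup>*" using h unfolding T'_def by blast
  have "e' \<in> T'" if "e' \<in> T" "v \<in> ends G e'" for e'
    using that assms(2) ends_connected[OF G, of e' v] xv rtrancl_trans[OF xv] unfolding T'_def by blast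
  then show thesis using that[of v e1] h xv unfolding T'_def by blast
qed

section \<open>Boundary points reached by a glued cycle\<close>

definition block_rel :: "nat set set \<Rightarrow> nat \<Rightarrow> nat \<Rightarrow> bool" where
  "block_rel P x y \<longleftrightarrow> x = y \<or> (\<exists>B\<in>P. x \<in> B \<and> y \<in> B)"

lemma block_rel_in:
  assumes "partition_on A P" "B \<in> P" "x \<in> B" "block_rel P x y"
  shows "y \<in> B"
proof (cases "x = y")
  case False
  then obtain B' where "B' \<in> P" "x \<in> B'" "y \<in> B'" using assms(4) by (auto simp: block_rel_def)
  then show ?thesis using disjointD[OF partition_onD2[OF assms(1)], of B B'] assms(2,3) by blast
qed (use assms in simp)

lemma equivp_block_rel:
  assumes "partition_on A P" shows "equivp (block_rel P)"
proof (intro equivpI reflpI sympI transpI)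
  show "block_rel P x z" if "block_rel P x y" "block_rel P y z" for x y z
    using that block_rel_in[OF assms, of _ y z] unfolding block_rel_def by blast
qed (auto simp: block_rel_def)

text \<open>The blocks cover \<open>{1..n}\<close>, so the component of \<open>Boundary i\<close> is
  the one that the representative forest provides for the block of \<open>i\<close>.\<close>

lemma block_rel_of_connected:
  assumes G: "representative_forest n P G" and P: "partition_on {1..n} P"
    and ij: "Boundary i \<in> verts G" "Boundary j \<in> verts G" "(Boundary i, Boundary j) \<in> (adjacency G)\<^sup>*"
  shows "block_rel P i j"
proof -
  have hb: "{i. Boundary i \<in> verts G} = {1..n}" using G by (simp add: representative_forest_def has_boundary_def)
  then have n: "i \<in> {1..n}" "j \<in> {1..n}" using ij by blast+
  then obtain B where B: "B \<in> P" "i \<in> B" using partition_onD1[OF P] by blast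
  then obtain C where C: "connected_component_of G C" "C \<inter> Boundary ` {1..n} = Boundary ` B"
    using G unfolding representative_forest_def by blast
  obtain u where u: "C = {v \<in> verts G. (u, v) \<in> (adjacency G)\<^sup>*}"
    using C(1) unfolding connected_component_of_def by blast
  have "Boundary i \<in> C" using B C(2) by blast
  then have "(u, Boundary j) \<in> (adjacency G)\<^sup>*" using ij(3) rtrancl_trans[of u "Boundary i"] unfolding u by blast
  then have "Boundary j \<in> C" using ij(2) unfolding u by blast
  then have "Boundary j \<in> Boundary ` B" using C(2) n(2) by blast
  then show ?thesis using B unfolding block_rel_def by auto
qed

text \<open>In \<open>K\<close> the vertex lies on a second edge. That edge cannot come from
  \<open>G\<close>, and the other side shares only boundary vertices with \<open>G\<close>.\<close>

lemma boundary_of_deficient: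
  assumes K: "edge_core K T" and f: "inj f" and ends: "\<And>e. ends K (h e) = f ` ends G e"
    and other: "\<forall>e'\<in>T. \<forall>v. f v \<in> ends K e' \<longrightarrow> e' \<notin> range h \<longrightarrow> (\<exists>i\<in>B. v = Boundary i)"
    and e: "h e \<in> T" "v \<in> ends G e" "ends G e \<noteq> {v}" "\<And>e'. h e' \<in> T \<Longrightarrow> v \<in> ends G e' \<Longrightarrow> e' = e"
  shows "\<exists>i\<in>B. v = Boundary i"
proof -
  have "f v \<in> ends K (h e)" using e(2) by (simp add: ends)
  moreover have "ends K (h e) \<noteq> {f v}"
    using e(3) inj_image_eq_iff[OF f, of "ends G e" "{v}"] by (simp add: ends)
  ultimately obtain e' where e': "e' \<in> T" "e' \<noteq> h e" "f v \<in> ends K e'"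
    using K e(1) unfolding edge_core_def by blast
  have "e' \<notin> range h"
    using e' e(4) f by (auto simp: ends inj_image_mem_iff)
  then show ?thesis using other e' by blast
qed

text \<open>General \<open>f\<close> and \<open>h\<close> let this serve both sides of the glue;
  \<open>B\<close> stands for the boundary points reached on the other side. Leaves of
  \<open>TG\<close> must continue there, and \<open>forest_leaf\<close> finds one in the component
  of \<open>Boundary i\<close>, hence in the block of \<open>i\<close>.\<close>

lemma core_partners_of_glued_side:
  fixes h :: "'e \<Rightarrow> 'f"
  assumes G: "representative_forest n P G" and P: "partition_on {1..n} P"
    and K: "edge_core K T" and f: "inj f" and ends: "\<And>e. ends K (h e) = f ` ends G e"
    and other: "\<forall>e'\<in>T. \<forall>v. f v \<in> ends K e' \<longrightarrow> e' \<notin> range h \<longrightarrow> (\<exists>i\<in>B. v = Boundary i)"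
    and TG: "TG = {e. h e \<in> T}" "TG \<subseteq> edges G"
  shows "TG \<noteq> {} \<Longrightarrow> \<exists>i\<in>B. \<exists>e\<in>TG. Boundary i \<in> ends G e"
    and "e \<in> TG \<Longrightarrow> Boundary i \<in> ends G e \<Longrightarrow>
      \<exists>j\<in>B. j \<noteq> i \<and> (\<exists>e\<in>TG. Boundary j \<in> ends G e) \<and> block_rel P i j"
proof -
  have forest: "is_forest G" using G by (simp add: representative_forest_def)
  then have mg: "is_multigraph G" and nc: "\<not> edge_core G TG"
    using contains_cycle_iff_edge_core unfolding is_forest_def by blast+
  have deficient: "\<exists>i\<in>B. v = Boundary i"
    if "e \<in> TG" "v \<in> ends G e" "ends G e \<noteq> {v}" "\<And>e'. e' \<in> TG \<Longrightarrow> v \<in> ends G e' \<Longrightarrow> e' = e" for e v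
    by (rule boundary_of_deficient[OF K f ends other]; use that TG(1) in blast)
  {
    assume "TG \<noteq> {}"
    then obtain e v where e: "e \<in> TG" "v \<in> ends G e" "ends G e \<noteq> {v}"
      "\<And>e'. e' \<in> TG \<Longrightarrow> v \<in> ends G e' \<Longrightarrow> e' = e"
      using nc TG(2) unfolding edge_core_def by blast
    then obtain i where "i \<in> B" "v = Boundary i" 
      using deficient[of e v] by blast
    then show "\<exists>i\<in>B. \<exists>e\<in>TG. Boundary i \<in> ends G e" using e by blast
  }
  {
    assume e: "e \<in> TG" "Boundary i \<in> ends G e"
    obtain v e1 where v: "v \<noteq> Boundary i" "(Boundary i, v) \<in> (adjacency G)\<^sup>*" "e1 \<in> TG" "v \<in> ends G e1"
      "ends G e1 \<noteq> {v}" "\<And>e'. e' \<in> TG \<Longrightarrow> v \<in> ends G e' \<Longrightarrow> e' = e1"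
      using forest_leaf[OF forest TG(2) e] by blast
    then obtain j where j: "j \<in> B" "v = Boundary j" 
      using deficient[of e1 v] by blast
    have "Boundary i \<in> verts G" "v \<in> verts G" using mg e v TG(2) unfolding is_multigraph_def by blast+
    then have "block_rel P i j" using block_rel_of_connected[OF G P] v(2) j by blast
    then show "\<exists>j\<in>B. j \<noteq> i \<and> (\<exists>e\<in>TG. Boundary j \<in> ends G e) \<and> block_rel P i j" using j v by blast
  }
qed

lemma inj_map_bvertex: "inj f \<Longrightarrow> inj (map_bvertex f)"
  by (rule bvertex.inj_map)

lemma map_bvertex_Inl_eq_Inr:
  "map_bvertex Inl v = map_bvertex Inr w \<longleftrightarrow> (\<exists>i. v = Boundary i \<and> w = Boundary i)"
  and map_bvertex_Inr_eq_Inl: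
  "map_bvertex Inr w = map_bvertex Inl v \<longleftrightarrow> (\<exists>i. v = Boundary i \<and> w = Boundary i)"
  by (cases v; cases w; auto)+

lemma is_multigraph_glue:
  assumes "is_multigraph G" "is_multigraph H" shows "is_multigraph (glue G H)"
proof -
  have card: "card (map_bvertex Inl ` ends G e) = card (ends G e)"
    "card (map_bvertex Inr ` ends H e') = card (ends H e')" for e e'
    by (auto intro!: card_image inj_on_subset[OF inj_map_bvertex])
  have "ends (glue G H) e \<subseteq> verts (glue G H) \<and> card (ends (glue G H) e) \<in> {1, 2}" if "e \<in> edges (glue G H)" for e
  proof (cases e)
    case (Inl a)
    then have "a \<in> edges G" using that by (auto simp: glue_def)
    then have "ends G a \<subseteq> verts G" "card (ends G a) \<in> {1, 2}" using assms unfolding is_multigraph_def by blast+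
    then show ?thesis using Inl card(1)[of a] by (auto simp: glue_def)
  next
    case (Inr b)
    then have "b \<in> edges H" using that by (auto simp: glue_def)
    then have "ends H b \<subseteq> verts H" "card (ends H b) \<in> {1, 2}" using assms unfolding is_multigraph_def by blast+
    then show ?thesis using Inr card(2)[of b] by (auto simp: glue_def)
  qed
  moreover have "finite (verts (glue G H))" "finite (edges (glue G H))"
    using assms by (auto simp: is_multigraph_def glue_def)
  ultimately show ?thesis unfolding is_multigraph_def by blast
qed

text \<open>The witness is the set of boundary points that the edge core reaches from both sides. It
  is nonempty because neither forest contains an edge core by itself.\<close>

lemma core_of_glue_cycle:
  assumes G: "representative_forest n P G" and P: "partition_on {1..n} P"
    and H: "representative_forest n Q H" and Q: "partition_on {1..n} Q"
    and cyc: "contains_cycle (glue G H)"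
  shows "core (block_rel P) (block_rel Q)"
proof -
  have mg: "is_multigraph G" "is_multigraph H" using G H by (auto simp: representative_forest_def is_forest_def)
  obtain T where T: "edge_core (glue G H) T"
    using cyc contains_cycle_iff_edge_core is_multigraph_glue[OF mg] by blast
  define TG where "TG = {e. Inl e \<in> T}"
  define TH where "TH = {e. Inr e \<in> T}"
  have sub: "TG \<subseteq> edges G" "TH \<subseteq> edges H"
    using T unfolding edge_core_def TG_def TH_def glue_def by auto
  define BG where "BG = {i. \<exists>e\<in>TG. Boundary i \<in> ends G e}"
  define BH where "BH = {i. \<exists>e\<in>TH. Boundary i \<in> ends H e}"
  have endsG: "ends (glue G H) (Inl e) = map_bvertex Inl ` ends G e"
    and endsH: "ends (glue G H) (Inr e') = map_bvertex Inr ` ends H e'" for e e' by (auto simp: glue_def)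
  have oG: "\<exists>i\<in>BH. v = Boundary i"
    if e': "e' \<in> T" "map_bvertex Inl v \<in> ends (glue G H) e'" "e' \<notin> range Inl" for e' v
  proof -
    obtain b where "e' = Inr b" using e'(3) by (cases e') auto
    moreover from this obtain i where "v = Boundary i" "Boundary i \<in> ends H b"
      using e'(2) by (auto simp: endsH map_bvertex_Inl_eq_Inr)
    ultimately show ?thesis using e'(1) unfolding BH_def TH_def by blast
  qed
  have oH: "\<exists>i\<in>BG. v = Boundary i"
    if e': "e' \<in> T" "map_bvertex Inr v \<in> ends (glue G H) e'" "e' \<notin> range Inr" for e' v
  proof -
    obtain b where "e' = Inl b" using e'(3) by (cases e') auto
    moreover from this obtain i where "v = Boundary i" "Boundary i \<in> ends G b"
      using e'(2) by (auto simp: endsG map_bvertex_Inr_eq_Inl)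
    ultimately show ?thesis using e'(1) unfolding BG_def TG_def by blast
  qed
  have oG': "\<forall>e'\<in>T. \<forall>v. map_bvertex Inl v \<in> ends (glue G H) e' \<longrightarrow> e' \<notin> range Inl \<longrightarrow> (\<exists>i\<in>BH. v = Boundary i)"
    and oH': "\<forall>e'\<in>T. \<forall>v. map_bvertex Inr v \<in> ends (glue G H) e' \<longrightarrow> e' \<notin> range Inr \<longrightarrow> (\<exists>i\<in>BG. v = Boundary i)"
    using oG oH by blast+
  note sideG = core_partners_of_glued_side[OF G P T inj_map_bvertex[OF inj_Inl] endsG oG' TG_def sub(1)]
  note sideH = core_partners_of_glued_side[OF H Q T inj_map_bvertex[OF inj_Inr] endsH oH' TH_def sub(2)]
  have "BG \<inter> BH \<noteq> {}"
  proof -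
    have "TG \<noteq> {} \<or> TH \<noteq> {}"
    proof -
      obtain e where "e \<in> T" using T unfolding edge_core_def by blast
      then show ?thesis unfolding TG_def TH_def by (cases e) auto
    qed
    then show ?thesis using sideG(1) sideH(1) unfolding BG_def BH_def by blast
  qed
  moreover have "finite (BG \<inter> BH)"
  proof (rule finite_subset)
    show "BG \<inter> BH \<subseteq> {i. Boundary i \<in> verts G}"
      using mg sub unfolding BG_def is_multigraph_def by blast
    show "finite {i. Boundary i \<in> verts G}"
      using G by (simp add: representative_forest_def has_boundary_def)
  qed
  moreover have "\<forall>i\<in>BG \<inter> BH. (\<exists>j\<in>BG \<inter> BH. j \<noteq> i \<and> block_rel P i j) \<and> (\<exists>j\<in>BG \<inter> BH. j \<noteq> i \<and> block_rel Q i j)"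
    using sideG(2) sideH(2) unfolding BG_def BH_def by blast
  ultimately show ?thesis unfolding core_def by blast
qed

section \<open>Star forests as canonical representatives\<close>

definition block_min :: "nat set set \<Rightarrow> nat \<Rightarrow> nat" where
  "block_min P i = (LEAST j. block_rel P i j)"

text \<open>One star per block, its centre named by the least element. In the glue of two star
  forests, \<open>Boundary i\<close> subdivides the edge \<open>i\<close> of the block
  multigraph.\<close>

definition star_forest :: "nat \<Rightarrow> nat set set \<Rightarrow> (nat bvertex, nat) multigraph" where
  "star_forest n P = \<lparr>verts = Boundary ` {1..n} \<union> Internal ` block_min P ` {1..n}, edges = {1..n},
     ends = (\<lambda>i. {Boundary i, Internal (block_min P i)})\<rparr>"

lemma block_min_eq_iff:
  assumes "partition_on A P"
  shows "block_min P i = block_min P j \<longleftrightarrow> block_rel P i j"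
proof
  note E = equivp_block_rel[OF assms]
  have "block_rel P i (block_min P i)" for i
    unfolding block_min_def by (rule LeastI[of _ i]) (simp add: block_rel_def)
  then show "block_rel P i j" if "block_min P i = block_min P j"
    using that equivp_symp[OF E] equivp_transp[OF E] by metis
  show "block_min P i = block_min P j" if "block_rel P i j"
  proof -
    have "block_rel P i = block_rel P j" using that E by (simp add: equivp_def)
    then show ?thesis by (simp add: block_min_def)
  qed
qed

lemma is_multigraph_star_forest: "is_multigraph (star_forest n P)"
  by (auto simp: is_multigraph_def star_forest_def)

lemma representative_star_forest:
  assumes P: "partition_on {1..n} P"
  shows "representative_forest n P (star_forest n P)"
proof -
  let ?G = "star_forest n P"
  have sel: "edges ?G = {1..n}" "ends ?G k = {Boundary k, Internal (block_min P k)}" for k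
    by (simp_all add: star_forest_def)
  \<comment> \<open>No other edge ends at \<open>Boundary i\<close>, so edge \<open>i\<close> is in
    no edge core.\<close>
  have "\<not> edge_core ?G T" for T
    unfolding edge_core_def by (auto simp: star_forest_def)
  then have "is_forest ?G"
    unfolding is_forest_def using contains_cycle_iff_edge_core is_multigraph_star_forest by blast
  moreover have "has_boundary n ?G" by (auto simp: has_boundary_def star_forest_def)
  moreover have "\<exists>C. connected_component_of ?G C \<and> C \<inter> Boundary ` {1..n} = Boundary ` B" if B: "B \<in> P" for B
  proof -
    obtain i where i: "i \<in> B" using B P by (metis all_not_in_conv partition_onD3)
    have Bn: "B \<subseteq> {1..n}" using B partition_onD1[OF P] by blast
    \<comment> \<open>The label is constant along edges and so tells the components apart.\<close>
    define label where "label v = (case v of Boundary j \<Rightarrow> block_min P j | Internal a \<Rightarrow> a)" for v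
    have "label v = label u" if "(u, v) \<in> (adjacency ?G)\<^sup>*" for u v
      using that
    proof (induction rule: rtrancl_induct)
      case (step v w)
      then obtain k where "{v, w} = {Boundary k, Internal (block_min P k)}"
        by (auto simp: adjacency_def star_forest_def)
      then show ?case using step.IH by (auto simp: doubleton_eq_iff label_def)
    qed simp
    then have only: "j \<in> B" if "(Boundary i, Boundary j) \<in> (adjacency ?G)\<^sup>*" for j
      using that block_min_eq_iff[OF P, of i j] block_rel_in[OF P B i] by (force simp: label_def)
    have conn: "(Boundary i, Boundary j) \<in> (adjacency ?G)\<^sup>*" if j: "j \<in> B" for j
    proof -
      have eq: "block_min P i = block_min P j"
        using block_min_eq_iff[OF P] i j B unfolding block_rel_def by blast
      have "(Boundary i, Internal (block_min P i)) \<in> (adjacency ?G)\<^sup>*"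
        "(Internal (block_min P j), Boundary j) \<in> (adjacency ?G)\<^sup>*"
        using ends_connected[OF is_multigraph_star_forest[of n P], of i]
          ends_connected[OF is_multigraph_star_forest[of n P], of j] i j Bn unfolding sel by blast+
      then show ?thesis using eq rtrancl_trans by metis
    qed
    let ?C = "{v \<in> verts ?G. (Boundary i, v) \<in> (adjacency ?G)\<^sup>*}"
    have "Boundary i \<in> verts ?G" using i Bn by (auto simp: star_forest_def)
    then have "connected_component_of ?G ?C" unfolding connected_component_of_def by blast
    moreover have "?C \<inter> Boundary ` {1..n} = Boundary ` B"
      using only conn Bn by (auto simp: star_forest_def)
    ultimately show ?thesis by blast
  qed
  ultimately show ?thesis unfolding representative_forest_def by blast
qed

text \<open>Any representatives with a cycle give a core. Conversely, in the glued star forests the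
  two edges at each point of a witness set form an edge core.\<close>

lemma induces_cycle_iff_core:
  assumes P: "partition_on {1..n} P" and Q: "partition_on {1..n} Q"
  shows "induces_cycle n P Q \<longleftrightarrow> core (block_rel P) (block_rel Q)"
proof
  show "core (block_rel P) (block_rel Q)" if "induces_cycle n P Q"
    using that core_of_glue_cycle[OF _ P _ Q] unfolding induces_cycle_def by blast
next
  assume "core (block_rel P) (block_rel Q)"
  then obtain S where S: "finite S" "S \<noteq> {}" "\<forall>x\<in>S. (\<exists>y\<in>S. y \<noteq> x \<and> block_rel P x y) \<and> (\<exists>y\<in>S. y \<noteq> x \<and> block_rel Q x y)"
    unfolding core_def by blast
  have Sn: "S \<subseteq> {1..n}"
  proof
    fix x assume "x \<in> S"
    then obtain B where "B \<in> P" "x \<in> B" using S(3) unfolding block_rel_def by blast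
    then show "x \<in> {1..n}" using partition_onD1[OF P] by blast
  qed
  let ?G = "star_forest n P" and ?H = "star_forest n Q"
  have "edge_core (glue ?G ?H) (Inl ` S \<union> Inr ` S)"
    unfolding edge_core_def
  proof (intro conjI ballI)
    show "Inl ` S \<union> Inr ` S \<subseteq> edges (glue ?G ?H)" using Sn by (auto simp: glue_def star_forest_def)
    show "Inl ` S \<union> Inr ` S \<noteq> {}" using S by auto
    fix e v assume e: "e \<in> Inl ` S \<union> Inr ` S" and v: "v \<in> ends (glue ?G ?H) e"
    have ends: "ends (glue ?G ?H) (Inl i) = {Boundary i, Internal (Inl (block_min P i))}"
      "ends (glue ?G ?H) (Inr i) = {Boundary i, Internal (Inr (block_min Q i))}" for i
      by (auto simp: glue_def star_forest_def)
    from e obtain i where i: "i \<in> S" "e = Inl i \<or> e = Inr i" by blast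
    obtain j k where "j \<in> S" "j \<noteq> i" "block_rel P i j" "k \<in> S" "k \<noteq> i" "block_rel Q i k"
      using S(3) i(1) by blast
    then have jk: "j \<in> S" "j \<noteq> i" "block_min P j = block_min P i"
      "k \<in> S" "k \<noteq> i" "block_min Q k = block_min Q i"
      using block_min_eq_iff[OF P, of i j] block_min_eq_iff[OF Q, of i k] by auto
    have "\<exists>e'\<in>Inl ` S \<union> Inr ` S. e' \<noteq> e \<and> v \<in> ends (glue ?G ?H) e'"
      using i(2)
    proof
      assume [simp]: "e = Inl i"
      show ?thesis
      proof (cases "v = Boundary i")
        case True
        then show ?thesis using i(1) by (intro bexI[of _ "Inr i"]) (auto simp: ends)
      next
        case False
        then show ?thesis using v jk by (intro bexI[of _ "Inl j"]) (auto simp: ends)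
      qed
    next
      assume [simp]: "e = Inr i"
      show ?thesis
      proof (cases "v = Boundary i")
        case True
        then show ?thesis using i(1) by (intro bexI[of _ "Inl i"]) (auto simp: ends)
      next
        case False
        then show ?thesis using v jk by (intro bexI[of _ "Inr k"]) (auto simp: ends)
      qed
    qed
    then show "ends (glue ?G ?H) e = {v} \<or> (\<exists>e'\<in>Inl ` S \<union> Inr ` S. e' \<noteq> e \<and> v \<in> ends (glue ?G ?H) e')" ..
  qed
  then have "contains_cycle (glue ?G ?H)"
    by (intro cycle_of_edge_core is_multigraph_glue is_multigraph_star_forest)
  then show "induces_cycle n P Q"
    unfolding induces_cycle_def using representative_star_forest P Q by blast
qed

section \<open>The rank bound\<close>

text \<open>All columns lie in the span of the vectors given by \<open>b\<close>, and Steinitz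
  exchange bounds the size of an independent set of columns.\<close>

lemma (in vec_space) rank_le_card_spanning:
  assumes A: "A \<in> carrier_mat n nc" and I: "finite I"
    and eq: "\<And>i j. i < n \<Longrightarrow> j < nc \<Longrightarrow> A $$ (i, j) = (\<Sum>x\<in>I. c j x * b x i)"
  shows "rank A \<le> card I"
proof -
  define W where "W = (\<lambda>x. vec n (b x)) ` I"
  have W: "finite W" "W \<subseteq> carrier_vec n" using I by (auto simp: W_def)
  have cols: "set (cols A) \<subseteq> span W"
  proof
    fix v assume "v \<in> set (cols A)"
    then obtain j where j: "j < nc" "v = col A j" using A by (auto simp: cols_def)
    \<comment> \<open>Different indices may give the same vector, so their coefficients are added
      up.\<close>
    define a where "a w = (\<Sum>x\<in>{x\<in>I. vec n (b x) = w}. c j x)" for w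
    have "v = lincomb a W"
    proof (rule eq_vecI)
      show dim: "dim_vec v = dim_vec (lincomb a W)" using j A W by (simp add: lincomb_dim)
      fix i assume "i < dim_vec (lincomb a W)"
      then have i: "i < n" using W by (simp add: lincomb_dim)
      have "lincomb a W $ i = (\<Sum>w\<in>W. a w * w $ i)" by (rule lincomb_index[OF i W(2)])
      also have "\<dots> = (\<Sum>w\<in>W. \<Sum>x\<in>{x\<in>I. vec n (b x) = w}. c j x * b x i)"
        using i by (auto simp: a_def sum_distrib_right intro!: sum.cong)
      also have "\<dots> = (\<Sum>x\<in>I. c j x * b x i)"
        by (rule sum.group) (use I in \<open>auto simp: W_def\<close>)
      also have "\<dots> = v $ i" using i j A eq[of i j] by simp
      finally show "v $ i = lincomb a W $ i" by simp
    qed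
    then show "v \<in> span W" using W by blast
  qed
  obtain U where U: "maximal U (\<lambda>T. T \<subseteq> set (cols A) \<and> lin_indpt T)"
    using maximal_exists[of "(\<lambda>T. T \<subseteq> set (cols A) \<and> lin_indpt T)" "card (set (cols A))" "{}"]
    by (meson List.finite_set card_mono empty_iff empty_subsetI finite_lin_indpt2 rev_finite_subset)
  then have "U \<subseteq> set (cols A)" "lin_indpt U" by (auto simp: maximal_def)
  moreover have "finite U" using calculation(1) finite_subset by blast
  ultimately have "card U \<le> card W"
    using replacement[of U W] W cols by fastforce
  also have "\<dots> \<le> card I" unfolding W_def by (rule card_image_le[OF I])
  finally show ?thesis using rank_card_indpt[OF A U] by simp
qed

lemma partition_rel_block_rel:
  assumes "partition_on {1..n} P"
  shows "partition_rel (Suc n) (block_rel P)"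
proof -
  have "x = y \<or> x < Suc n \<and> y < Suc n" if "block_rel P x y" for x y
  proof (cases "x = y")
    case False
    then have "x \<in> \<Union> P" "y \<in> \<Union> P" using that unfolding block_rel_def by blast+
    then show ?thesis unfolding partition_onD1[OF assms, symmetric] by simp
  qed simp
  then show ?thesis using equivp_block_rel[OF assms] by (simp add: partition_rel_def)
qed

text \<open>Deleting the isolated point 0 shifts \<open>{1..n}\<close> to \<open>{0..<n}\<close>.
  The arguments are exchanged, by symmetry of \<open>core\<close>, because the rank bound expands
  columns.\<close>

lemma acyclic_entry_block_rel:
  assumes P: "partition_on {1..n} P" and Q: "partition_on {1..n} Q"
  shows "(if induces_cycle n P Q then 0 else 1) =
    acyclic_entry (delete_point 0 (block_rel Q)) (delete_point 0 (block_rel P))"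
proof -
  have "y = 0" if "block_rel P 0 y" for y
  proof (rule ccontr)
    assume "y \<noteq> 0"
    then have "0 \<in> \<Union> P" using that unfolding block_rel_def by blast
    then show False unfolding partition_onD1[OF P, symmetric] by simp
  qed
  then have "core (block_rel P) (block_rel Q) \<longleftrightarrow>
      core (delete_point 0 (block_rel P)) (delete_point 0 (block_rel Q))"
    by (rule core_delete_isolated)
  then show ?thesis
    by (simp add: acyclic_entry_def induces_cycle_iff_core[OF P Q] core_commute)
qed

lemma set_partition_list: "set (partition_list n) = {P. partition_on {1..n} P}"
proof -
  have "finite {P. partition_on {1..n} P}"
    by (rule finite_subset[of _ "Pow (Pow {1..n})"]) (auto simp: partition_on_def)
  then have "\<exists>Ps. distinct Ps \<and> set Ps = {P. partition_on {1..n} P}"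
    using finite_distinct_list by metis
  from someI_ex[OF this] show ?thesis unfolding partition_list_def by blast
qed

lemma card_normal_forms_le_catalan:
  assumes "n > 0" shows "real (card (normal_forms n 0)) \<le> catalan n"
proof -
  obtain m where m: "n = Suc m" using assms by (cases n) auto
  \<comment> \<open>This is \<open>2 * n - 1\<close>, the upper index in
    \<open>card_normal_forms\<close> at \<open>p = 0\<close>.\<close>
  define N where "N = 2 * m + 1"
  have "real (card (normal_forms n 0)) \<le> real (N choose n) - real (N choose Suc n)"
    using card_normal_forms[OF assms, of 0] by (simp add: m N_def)
  also have "\<dots> = catalan n"
  proof -
    have sym: "N choose n = N choose m"
      using binomial_symmetric[of n N] by (simp add: m N_def)
    have "N - n = m" by (simp add: m N_def)
    then have "Suc n * (N choose Suc n) = m * (N choose n)"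
      using binomial_absorb_comp[of N n] binomial_absorption[of n N] by metis
    then have e: "real (Suc n) * real (N choose Suc n) = real (N choose n) * real m"
      by (metis of_nat_mult mult.commute)
    have "(2 * n) choose n = (N choose m) + (N choose n)"
      by (simp add: m N_def)
    then have c: "catalan n = 2 * real (N choose n) / real (Suc n)"
      by (simp add: catalan_def sym)
    have d: "real (N choose Suc n) = real (N choose n) * real m / real (Suc n)"
      using e by (simp add: field_simps)
    show ?thesis unfolding c d by (simp add: m field_simps)
  qed
  finally show ?thesis .
qed

lemma rank_forest_compat_matrix_le_catalan:
  assumes "n > 0"
  shows "real (real_rank (forest_compat_matrix n)) \<le> catalan n"
proof -
  define Ps where "Ps = partition_list n"
  define R where "R k = delete_point 0 (block_rel (Ps ! k))" for k
  have Ps: "partition_on {1..n} (Ps ! k)" if "k < length Ps" for k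
    using that nth_mem set_partition_list unfolding Ps_def by blast
  have R: "partition_rel n (R k)" if "k < length Ps" for k
    unfolding R_def by (intro partition_rel_delete partition_rel_block_rel Ps that) simp
  have "\<exists>c. \<forall>Q. partition_rel n Q \<longrightarrow> acyclic_entry (R k) Q = (\<Sum>N\<in>normal_forms n 0. c N * acyclic_entry N Q)"
    if "k < length Ps" for k
    using spanned_partition_rel[OF assms R[OF that]] unfolding spanned_def .
  then obtain c where c: "\<And>k Q. k < length Ps \<Longrightarrow> partition_rel n Q \<Longrightarrow>
      acyclic_entry (R k) Q = (\<Sum>N\<in>normal_forms n 0. c k N * acyclic_entry N Q)" by metis
  let ?A = "forest_compat_matrix n"
  have A: "?A \<in> carrier_mat (length Ps) (length Ps)"
    by (simp add: forest_compat_matrix_def Ps_def Let_def)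
  have "vec_space.rank (length Ps) ?A \<le> card (normal_forms n 0)"
  proof (rule vec_space.rank_le_card_spanning[OF A])
    show "finite (normal_forms n 0)" using card_normal_forms[OF assms] by blast
    fix i j assume ij: "i < length Ps" "j < length Ps"
    have "?A $$ (i, j) = acyclic_entry (R j) (R i)"
      using ij acyclic_entry_block_rel[OF Ps Ps, of i j]
      by (simp add: forest_compat_matrix_def Ps_def Let_def R_def)
    then show "?A $$ (i, j) = (\<Sum>N\<in>normal_forms n 0. c j N * acyclic_entry N (R i))"
      using c[OF ij(2) R[OF ij(1)]] by simp
  qed
  then have "real (real_rank ?A) \<le> real (card (normal_forms n 0))"
    using A by (simp add: real_rank_def)
  then show ?thesis using card_normal_forms_le_catalan[OF assms] by linarith
qed

section \<open>Growth of the Catalan numbers\<close>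

lemma central_binomial_sq_le: "real ((2 * n) choose n) ^ 2 * (2 * real n + 1) \<le> 16 ^ n"
proof (induction n)
  case (Suc n)
  let ?c = "real ((2 * n) choose n)"
  have "Suc n * ((2 * Suc n) choose Suc n) = 2 * (2 * n + 1) * ((2 * n) choose n)"
  proof -
    have "Suc n * (Suc (2 * n) choose Suc n) = Suc (2 * n) * ((2 * n) choose n)"
      using Suc_times_binomial_eq[of "2 * n" n] by (metis mult.commute)
    moreover have "(2 * Suc n) choose Suc n = 2 * (Suc (2 * n) choose Suc n)"
      using binomial_symmetric[of n "Suc (2 * n)"] by simp
    ultimately show ?thesis by (simp add: algebra_simps)
  qed
  then have "real (Suc n * ((2 * Suc n) choose Suc n)) = real (2 * (2 * n + 1) * ((2 * n) choose n))"
    by (rule arg_cong)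
  then have "real (Suc n) * real ((2 * Suc n) choose Suc n) = 2 * (2 * real n + 1) * ?c"
    by (simp only: of_nat_mult of_nat_add of_nat_numeral of_nat_1)
  then have c: "real ((2 * Suc n) choose Suc n) = 2 * (2 * real n + 1) * ?c / (real n + 1)"
    by (simp add: field_simps)
  have "real ((2 * Suc n) choose Suc n) ^ 2 * (2 * real (Suc n) + 1) =
      (?c ^ 2 * (2 * real n + 1)) * (4 * (2 * real n + 1) * (2 * real n + 3) / (real n + 1) ^ 2)"
    unfolding c by (simp add: power2_eq_square algebra_simps)
  also have "\<dots> \<le> 16 ^ n * 16"
  proof (rule mult_mono[OF Suc.IH])
    \<comment> \<open>This amounts to
      \<open>(2 * n + 1) * (2 * n + 3) \<le> (2 * n + 2) ^ 2\<close>; the factor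
      \<open>2 * n + 1\<close> in the claim produces this ratio.\<close>
    show "4 * (2 * real n + 1) * (2 * real n + 3) / (real n + 1) ^ 2 \<le> 16"
      by (subst pos_divide_le_eq, simp, simp add: power2_eq_square algebra_simps)
  qed auto
  finally show ?case by simp
qed simp

lemma catalan_bigo: "catalan \<in> O(\<lambda>n. 4 ^ n * real n powr (- 3 / 2))"
proof (rule bigoI[where c = 1])
  show "eventually (\<lambda>n. norm (catalan n) \<le> 1 * norm (4 ^ n * real n powr (- 3 / 2))) sequentially"
    using eventually_gt_at_top[of 0]
  proof eventually_elim
    case (elim n)
    let ?c = "real ((2 * n) choose n)"
    \<comment> \<open>The square root gives a bound of \<open>4 ^ n / sqrt n\<close> for the central
      binomial; the denominator \<open>n + 1\<close> of the Catalan number supplies the remaining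
      factor \<open>1 / n\<close>.\<close>
    have "?c ^ 2 * real n \<le> ?c ^ 2 * (2 * real n + 1)" by (rule mult_left_mono) auto
    also have "\<dots> \<le> 16 ^ n" by (rule central_binomial_sq_le)
    finally have "(?c * sqrt (real n)) ^ 2 \<le> (4 ^ n) ^ 2"
      by (simp add: power_mult_distrib power_mult[symmetric] mult.commute[of n 2] power_mult)
    then have "?c * sqrt (real n) \<le> 4 ^ n" by (rule power2_le_imp_le) simp
    then have c: "?c \<le> 4 ^ n / sqrt (real n)" using elim by (simp add: field_simps)
    have "real n powr (- 3 / 2) = 1 / (sqrt (real n) * real n)"
    proof -
      have "real n powr (3 / 2) = real n powr (1 / 2 + 1)" by simp
      also have "\<dots> = sqrt (real n) * real n" using elim by (simp only: powr_add powr_half_sqrt) simp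
      finally show ?thesis using powr_minus_divide[of "real n" "3 / 2"] by simp
    qed
    moreover have "catalan n \<le> ?c / real n"
      using elim by (simp add: catalan_def frac_le)
    moreover have "?c / real n \<le> 4 ^ n / sqrt (real n) / real n"
      using c by (rule divide_right_mono) simp
    ultimately have "catalan n \<le> 4 ^ n * real n powr (- 3 / 2)" by simp
    then show ?case by (simp add: catalan_def)
  qed
qed

theorem theorem14:
  shows "(\<forall>n>0. real (real_rank (forest_compat_matrix n)) \<le> catalan n) \<and>
    (\<lambda>n. real (real_rank (forest_compat_matrix n))) \<in> O(\<lambda>n. 4 ^ n * real n powr (- 3 / 2))"
proof
  show bound: "\<forall>n>0. real (real_rank (forest_compat_matrix n)) \<le> catalan n"
    using rank_forest_compat_matrix_le_catalan by blast
  have "(\<lambda>n. real (real_rank (forest_compat_matrix n))) \<in> O(catalan)"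
  proof (rule bigoI[where c = 1])
    show "eventually (\<lambda>n. norm (real (real_rank (forest_compat_matrix n))) \<le> 1 * norm (catalan n)) sequentially"
      using eventually_gt_at_top[of 0] by eventually_elim (use bound in \<open>simp add: catalan_def\<close>)
  qed
  then show "(\<lambda>n. real (real_rank (forest_compat_matrix n))) \<in> O(\<lambda>n. 4 ^ n * real n powr (- 3 / 2))"
    using catalan_bigo by (rule landau_o.big_trans)
qed

end
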